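(* Let $\varphi(z)=\frac{az+b}{cz+d}$ be a fractional linear map with $|a|^2+|b|^2+2|\bar a b-\bar c d|\le|c|^2+|d|^2$ and $|c|\le|d|$ (so that $\varphi$ maps $\mathbb{D}$ into $\mathbb{D}$), and consider $C_\varphi$ acting on the Hardy space $H^2$. Then, with $K=\overline{\varphi(\mathbb{D})}$, the limit $\beta(C_\varphi)=\lim_{n\to\infty}[a_n(C_\varphi)]^{1/n}$ exists and $\beta(C_\varphi)=\exp(-1/\operatorname{Cap}(K))$ (with the conventions $e^{-1/\infty}=1$, $e^{-1/0}=0$).
   Context: $H^2$ is the Hardy space of the unit disk $\mathbb{D}$; $C_\varphi f=f\circ\varphi$. Approximation numbers: $a_n(T)=\inf\{\|T-R\| : \operatorname{rank}R<n\}$. Green capacity: with $g(z,w)=\log\left|\frac{1-\bar w z}{z-w}\right|$, energy $I(\mu)=\iint g\,d\mu\,d\mu$, $V(E)=\inf I(\mu)$ over probability measures supported by a compact subset of $E\subseteq\mathbb{D}$, and $\operatorname{Cap}(E)=1/V(E)$. *)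

theory Defs
  imports "HOL-Probability.Probability"
begin

abbreviation unit_disk :: "complex set" where "unit_disk \<equiv> ball 0 1"

text \<open>Taylor coefficients at 0 and the Hardy space H^2 of the unit disk.
  Elements are represented by functions holomorphic on the disk and set to 0 outside it,
  so that H^2 is a genuine linear space of functions.\<close>
definition taylor_coeff :: "(complex \<Rightarrow> complex) \<Rightarrow> nat \<Rightarrow> complex" where
  "taylor_coeff f n = (deriv ^^ n) f 0 / fact n"

definition H2 :: "(complex \<Rightarrow> complex) set" where
  "H2 = {f. f holomorphic_on unit_disk \<and> (\<forall>z. z \<notin> unit_disk \<longrightarrow> f z = 0)
            \<and> summable (\<lambda>n. (cmod (taylor_coeff f n))\<^sup>2)}"

definition h2_norm :: "(complex \<Rightarrow> complex) \<Rightarrow> real" where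
  "h2_norm f = sqrt (\<Sum>n. (cmod (taylor_coeff f n))\<^sup>2)"

definition h2_opnorm :: "((complex \<Rightarrow> complex) \<Rightarrow> (complex \<Rightarrow> complex)) \<Rightarrow> ereal" where
  "h2_opnorm T = (SUP f\<in>{f\<in>H2. h2_norm f \<le> 1}. ereal (h2_norm (T f)))"

definition h2_linear_op :: "((complex \<Rightarrow> complex) \<Rightarrow> (complex \<Rightarrow> complex)) \<Rightarrow> bool" where
  "h2_linear_op R \<longleftrightarrow> (\<forall>f\<in>H2. R f \<in> H2) \<and>
     (\<forall>f\<in>H2. \<forall>g\<in>H2. R (\<lambda>z. f z + g z) = (\<lambda>z. R f z + R g z)) \<and>
     (\<forall>f\<in>H2. \<forall>c::complex. R (\<lambda>z. c * f z) = (\<lambda>z. c * R f z))"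

definition rank_less :: "((complex \<Rightarrow> complex) \<Rightarrow> (complex \<Rightarrow> complex)) \<Rightarrow> nat \<Rightarrow> bool" where
  "rank_less R n \<longleftrightarrow> (\<exists>B. finite B \<and> card B < n \<and>
      (\<forall>f\<in>H2. \<exists>c. R f = (\<lambda>z. \<Sum>b\<in>B. c b * b z)))"

definition approx_num_ext :: "((complex \<Rightarrow> complex) \<Rightarrow> (complex \<Rightarrow> complex)) \<Rightarrow> nat \<Rightarrow> ereal" where
  "approx_num_ext T n = (INF R\<in>{R. h2_linear_op R \<and> rank_less R n}.
                            h2_opnorm (\<lambda>f z. T f z - R f z))"

definition approx_num :: "((complex \<Rightarrow> complex) \<Rightarrow> (complex \<Rightarrow> complex)) \<Rightarrow> nat \<Rightarrow> real" where
  "approx_num T n = real_of_ereal (approx_num_ext T n)"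

definition comp_op :: "(complex \<Rightarrow> complex) \<Rightarrow> (complex \<Rightarrow> complex) \<Rightarrow> (complex \<Rightarrow> complex)" where
  "comp_op \<phi> f = (\<lambda>z. if z \<in> unit_disk then f (\<phi> z) else 0)"

definition green :: "complex \<Rightarrow> complex \<Rightarrow> ennreal" where
  "green z w = (if z = w then \<infinity> else ennreal (ln (cmod ((1 - cnj w * z) / (z - w)))))"

definition green_energy :: "complex measure \<Rightarrow> ennreal" where
  "green_energy \<mu> = (\<integral>\<^sup>+ z. (\<integral>\<^sup>+ w. green z w \<partial>\<mu>) \<partial>\<mu>)"

definition admissible_measures :: "complex set \<Rightarrow> complex measure set" where
  "admissible_measures E = {\<mu>. sets \<mu> = sets borel \<and> prob_space \<mu> \<and>
      (\<exists>L. compact L \<and> L \<subseteq> E \<inter> unit_disk \<and> emeasure \<mu> (UNIV - L) = 0)}"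

definition green_V :: "complex set \<Rightarrow> ennreal" where
  "green_V E = (INF \<mu>\<in>admissible_measures E. green_energy \<mu>)"

definition green_cap :: "complex set \<Rightarrow> ennreal" where
  "green_cap E = (if green_V E = 0 then \<infinity> else inverse (green_V E))"

definition exp_neg_inv :: "ennreal \<Rightarrow> real" where
  "exp_neg_inv c = (if c = \<infinity> then 1 else if c = 0 then 0 else exp (- 1 / enn2real c))"

end

theory Submission
  imports Defs "HOL-Complex_Analysis.Complex_Analysis" "HOL-Library.Function_Algebras"
begin

text \<open>
  By Littlewood's subordination principle \<open>C\<^sub>\<psi>\<close> is bounded on \<open>H\<^sup>2\<close> for every holomorphic self-map
  \<open>\<psi>\<close> of the disk, so \<open>a\<^sub>n (C\<^sub>\<tau> C\<^sub>\<phi> C\<^sub>\<psi>) \<le> C * a\<^sub>n (C\<^sub>\<phi>)\<close>, where \<open>C\<^sub>\<tau> C\<^sub>\<phi> C\<^sub>\<psi>\<close> is composition with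
  \<open>\<psi> \<circ> \<phi> \<circ> \<tau>\<close>. The dilation \<open>z \<mapsto> s z\<close> induces the diagonal operator with entries \<open>s ^ k\<close>, whose
  approximation numbers are known exactly. If the image of a univalent \<open>\<phi>\<close> lies in a pseudohyperbolic
  disk of radius \<open>\<beta>\<close>, then \<open>\<phi>\<close> factors through the dilation by \<open>\<beta>\<close>; if it contains one of radius \<open>s\<close>,
  the dilation by \<open>s\<close> factors through \<open>\<phi>\<close>. Hence \<open>a\<^sub>n (C\<^sub>\<phi>)\<close> decays like \<open>\<beta> ^ n\<close> as soon as the image
  lies in such a disk of radius \<open>\<beta>\<close> and contains disks of every radius \<open>s < \<beta>\<close>.

  Green energy is conformally invariant, and \<open>V = ln (1 / s)\<close> for the closed disk of radius \<open>s\<close>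
  about \<open>0\<close>: the uniform measure on the boundary circle attains this value, and no measure does
  better because, after rescaling, the Green kernel exceeds \<open>ln (1 / s)\<close> by at least a positive
  definite kernel. So the image above has \<open>V = ln (1 / \<beta>)\<close> too.

  Under the assumptions \<open>\<phi>\<close> maps the disk univalently onto a Euclidean disk \<open>ball w r\<close> with
  \<open>\<bar>w\<bar> + r \<le> 1\<close>. If \<open>\<bar>w\<bar> + r < 1\<close> this is itself a pseudohyperbolic disk; if \<open>\<bar>w\<bar> + r = 1\<close> it contains
  pseudohyperbolic disks of every radius \<open>s < 1\<close>, and \<open>\<beta> = 1\<close>.
\<close>

section \<open>Taylor coefficients and circle means\<close>

lemma taylor_coeff_eq_fps_nth: "f has_fps_expansion F \<Longrightarrow> taylor_coeff f n = fps_nth F n"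
  by (simp add: taylor_coeff_def fps_nth_fps_expansion)

lemma has_fps_expansion_taylor_coeff:
  assumes "f holomorphic_on unit_disk"
  shows "f has_fps_expansion Abs_fps (taylor_coeff f)"
proof -
  have "f has_fps_expansion fps_expansion f 0"
    using assms by (intro has_fps_expansion_fps_expansion[of unit_disk]) auto
  thus ?thesis by (simp add: fps_expansion_def taylor_coeff_def[abs_def])
qed

lemma taylor_coeff_cong:
  assumes "\<And>z. z \<in> unit_disk \<Longrightarrow> f z = g z"
  shows "taylor_coeff f n = taylor_coeff g n"
  unfolding taylor_coeff_def
  by (subst higher_deriv_cong_ev[where g = g and y = 0])
     (use assms in \<open>auto intro!: eventually_nhds_in_open[THEN eventually_mono, of unit_disk]\<close>)

lemma taylor_coeff_add:
  assumes "f holomorphic_on unit_disk" "g holomorphic_on unit_disk"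
  shows "taylor_coeff (\<lambda>z. f z + g z) n = taylor_coeff f n + taylor_coeff g n"
  using assms[THEN has_fps_expansion_taylor_coeff]
  by (subst taylor_coeff_eq_fps_nth[OF has_fps_expansion_add]) auto

lemma taylor_coeff_diff:
  assumes "f holomorphic_on unit_disk" "g holomorphic_on unit_disk"
  shows "taylor_coeff (\<lambda>z. f z - g z) n = taylor_coeff f n - taylor_coeff g n"
  using assms[THEN has_fps_expansion_taylor_coeff]
  by (subst taylor_coeff_eq_fps_nth[OF has_fps_expansion_diff]) auto

lemma taylor_coeff_cmult:
  assumes "f holomorphic_on unit_disk"
  shows "taylor_coeff (\<lambda>z. c * f z) n = c * taylor_coeff f n"
  using has_fps_expansion_taylor_coeff[OF assms]
  by (subst taylor_coeff_eq_fps_nth[OF has_fps_expansion_cmult_left]) auto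

lemma taylor_coeff_polynomial:
  "taylor_coeff (\<lambda>z. \<Sum>k<m. c k * z ^ k) n = (if n < m then c n else 0)"
proof -
  have "(\<lambda>z. \<Sum>k<m. c k * z ^ k) has_fps_expansion (\<Sum>k<m. fps_const (c k) * fps_X ^ k)"
    by (intro fps_expansion_intros)
  hence "taylor_coeff (\<lambda>z. \<Sum>k<m. c k * z ^ k) n = (\<Sum>k<m. c k * (if n = k then 1 else 0))"
    by (simp add: taylor_coeff_eq_fps_nth fps_sum_nth)
  thus ?thesis by (simp add: if_distrib[of "(*) _"] cong: if_cong)
qed

lemma taylor_coeff_dilation:
  assumes "f holomorphic_on unit_disk" "cmod s \<le> 1"
  shows "taylor_coeff (\<lambda>z. f (s * z)) n = s ^ n * taylor_coeff f n"
proof -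
  have "(deriv ^^ n) (\<lambda>z. f (s * z)) 0 = s ^ n * (deriv ^^ n) f (s * 0)"
    using assms
    by (intro higher_deriv_compose_linear[of f unit_disk unit_disk])
       (auto simp: norm_mult intro: le_less_trans[OF mult_left_le_one_le])
  thus ?thesis by (simp add: taylor_coeff_def)
qed

lemma taylor_series_sums:
  assumes "f holomorphic_on unit_disk" "cmod z < 1"
  shows "(\<lambda>k. taylor_coeff f k * z ^ k) sums f z"
  using holomorphic_power_series[OF assms(1), of z] assms(2) by (simp add: taylor_coeff_def)

lemma uniform_limit_taylor_polynomials:
  assumes f: "f holomorphic_on unit_disk" and \<rho>: "0 \<le> \<rho>" "\<rho> < 1"
  shows "uniform_limit (cball 0 \<rho>) (\<lambda>N z. \<Sum>k<N. taylor_coeff f k * z ^ k) f sequentially"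
proof -
  obtain r where r: "\<rho> < r" "r < 1" using dense[OF \<rho>(2)] by blast
  have "summable (\<lambda>k. taylor_coeff f k * of_real r ^ k)"
    using taylor_series_sums[OF f, of "of_real r"] r \<rho> by (simp add: sums_iff)
  hence "ereal (norm (of_real r :: complex)) \<le> conv_radius (taylor_coeff f)" by (rule conv_radius_geI)
  moreover have "norm (of_real r :: complex) = r" using r \<rho> by simp
  ultimately have "ereal \<rho> < conv_radius (taylor_coeff f)"
    using r by (metis ereal_less(2) ereal_less_eq(3) less_ereal.simps(1) less_le_trans)
  hence "uniform_limit (cball 0 \<rho>) (\<lambda>N z. \<Sum>k<N. taylor_coeff f k * (z - 0) ^ k)
      (\<lambda>z. \<Sum>k. taylor_coeff f k * (z - 0) ^ k) sequentially"
    by (rule powser_uniform_limit)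
  also have "?this \<longleftrightarrow> ?thesis"
    using taylor_series_sums[OF f] \<rho> by (intro uniform_limit_cong) (auto simp: sums_iff)
  finally show ?thesis .
qed

lemma norm_circlepath_0 [simp]: "cmod (circlepath 0 r t) = \<bar>r\<bar>"
  by (simp add: circlepath norm_mult)

lemma circlepath_0_nonzero: "r \<noteq> 0 \<Longrightarrow> circlepath 0 r t \<noteq> 0"
  by (simp add: circlepath)

lemma continuous_on_circlepath [continuous_intros]: "continuous_on A (circlepath z r)"
  unfolding circlepath by (intro continuous_intros)

lemma taylor_coeff_has_integral_circlepath:
  assumes f: "f holomorphic_on ball 0 R" and r: "0 < r" "r < R"
  shows "((\<lambda>t. f (circlepath 0 r t) / circlepath 0 r t ^ n) has_integral taylor_coeff f n) {0..1}"
proof -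
  let ?c = "circlepath 0 r"
  have "((\<lambda>u. f u / (u - 0) ^ Suc n) has_contour_integral
          (2 * pi * \<i> / fact n) * (deriv ^^ n) f 0) ?c"
    using r
    by (intro Cauchy_has_contour_integral_higher_derivative_circlepath holomorphic_on_imp_continuous_on
          holomorphic_on_subset[OF f]) auto
  hence contour: "((\<lambda>t. f (?c t) / ?c t ^ Suc n * vector_derivative ?c (at t within {0..1}))
          has_integral (2 * pi * \<i>) * taylor_coeff f n) {0..1}"
    by (simp add: has_contour_integral_def taylor_coeff_def)
  have "((\<lambda>t. (2 * pi * \<i>) * (f (?c t) / ?c t ^ n))
      has_integral (2 * pi * \<i>) * taylor_coeff f n) {0..1}"
  proof (rule has_integral_eq[OF _ contour])
    fix t :: real assume "t \<in> {0..1}"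
    hence "vector_derivative ?c (at t within {0..1}) = 2 * pi * \<i> * ?c t"
      by (subst vector_derivative_circlepath01) (auto simp: circlepath)
    thus "f (?c t) / ?c t ^ Suc n * vector_derivative ?c (at t within {0..1})
        = (2 * pi * \<i>) * (f (?c t) / ?c t ^ n)"
      using r circlepath_0_nonzero[of r t] by simp
  qed
  thus ?thesis by (subst (asm) has_integral_mult_right_iff) auto
qed

corollary circlepath_mean_value:
  assumes "f holomorphic_on ball 0 R" "0 < r" "r < R"
  shows "((\<lambda>t. f (circlepath 0 r t)) has_integral f 0) {0..1}"
  using taylor_coeff_has_integral_circlepath[OF assms, of 0] by (simp add: taylor_coeff_def)

corollary circlepath_mean_value_Re:
  assumes "f holomorphic_on ball 0 R" "0 < r" "r < R"
  shows "((\<lambda>t. Re (f (circlepath 0 r t))) has_integral Re (f 0)) {0..1}"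
  using has_integral_linear[OF circlepath_mean_value[OF assms] bounded_linear_Re] by (simp add: o_def)

lemma circlepath_mean_value_ln_norm:
  assumes h: "h holomorphic_on ball 0 R" "\<And>z. z \<in> ball 0 R \<Longrightarrow> h z \<noteq> 0" and r: "0 < r" "r < R"
  shows "((\<lambda>t. ln (cmod (h (circlepath 0 r t)))) has_integral ln (cmod (h 0))) {0..1}"
proof -
  obtain g where g: "g holomorphic_on ball 0 R" "\<And>z. z \<in> ball 0 R \<Longrightarrow> h z = exp (g z)"
    using contractible_imp_holomorphic_log[OF h(1) convex_imp_contractible[OF convex_ball] h(2)]
    by blast
  have "Re (g z) = ln (cmod (h z))" if "z \<in> ball 0 R" for z
    using g(2)[OF that] by simp
  thus ?thesis using circlepath_mean_value_Re[OF g(1) r] r by simp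
qed

lemma circlepath_inner_product_polynomial:
  assumes f: "f holomorphic_on ball 0 R" and r: "0 < r" "r < R"
  shows "((\<lambda>t. f (circlepath 0 r t) * cnj (\<Sum>k<m. c k * circlepath 0 r t ^ k)) has_integral
           (\<Sum>k<m. taylor_coeff f k * (cnj (c k) * of_real (r ^ (2 * k))))) {0..1}"
proof (rule has_integral_eq)
  show "((\<lambda>t. \<Sum>k<m. f (circlepath 0 r t) / circlepath 0 r t ^ k * (cnj (c k) * of_real (r ^ (2 * k))))
      has_integral (\<Sum>k<m. taylor_coeff f k * (cnj (c k) * of_real (r ^ (2 * k))))) {0..1}"
    by (intro has_integral_sum has_integral_mult_left taylor_coeff_has_integral_circlepath[OF f r]) auto
next
  fix t :: real
  define u where "u = circlepath 0 r t"
  have "of_real (r ^ (2 * k)) = u ^ k * cnj u ^ k" for k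
    using complex_norm_square[of u] r by (simp add: u_def power_mult flip: power_mult_distrib)
  moreover have "u \<noteq> 0" using r by (simp add: u_def circlepath_0_nonzero)
  ultimately show "(\<Sum>k<m. f u / u ^ k * (cnj (c k) * of_real (r ^ (2 * k))))
      = f u * cnj (\<Sum>k<m. c k * u ^ k)"
    by (simp add: sum_distrib_left field_simps)
qed

lemma integrable_norm_square_circlepath:
  assumes f: "f holomorphic_on ball 0 R" and r: "0 < r" "r < R"
  shows "(\<lambda>t. (cmod (f (circlepath 0 r t)))\<^sup>2) integrable_on {0..1}"
proof -
  have "circlepath 0 r ` {0..1} \<subseteq> ball 0 R" using r by auto
  thus ?thesis
    by (intro integrable_continuous_interval continuous_intros
          continuous_on_compose2[OF holomorphic_on_imp_continuous_on[OF f]])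
qed

lemma bessel_inequality_circlepath:
  assumes f: "f holomorphic_on ball 0 R" and r: "0 < r" "r < R"
  shows "(\<Sum>k<m. (cmod (taylor_coeff f k))\<^sup>2 * r ^ (2 * k))
           \<le> integral {0..1} (\<lambda>t. (cmod (f (circlepath 0 r t)))\<^sup>2)"
proof -
  define P where "P = (\<lambda>z. \<Sum>k<m. taylor_coeff f k * z ^ k)"
  define Q where "Q = (\<Sum>k<m. (cmod (taylor_coeff f k))\<^sup>2 * r ^ (2 * k))"
  let ?c = "circlepath 0 r"
  have Q: "(\<Sum>k<m. taylor_coeff f k * (cnj (taylor_coeff f k) * of_real (r ^ (2 * k))))
      = complex_of_real Q"
    unfolding Q_def by (simp add: complex_norm_square mult.assoc flip: of_real_power)
  have f_P: "((\<lambda>t. f (?c t) * cnj (P (?c t))) has_integral complex_of_real Q) {0..1}"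
    unfolding Q[symmetric] P_def by (rule circlepath_inner_product_polynomial[OF f r])
  have "((\<lambda>t. P (?c t) * cnj (P (?c t))) has_integral
      (\<Sum>k<m. taylor_coeff P k * (cnj (taylor_coeff f k) * of_real (r ^ (2 * k))))) {0..1}"
    unfolding P_def
    by (rule circlepath_inner_product_polynomial[OF _ r]) (intro holomorphic_intros)
  also have "(\<Sum>k<m. taylor_coeff P k * (cnj (taylor_coeff f k) * of_real (r ^ (2 * k))))
      = complex_of_real Q"
    unfolding Q[symmetric] by (intro sum.cong refl) (simp add: P_def taylor_coeff_polynomial)
  finally have P_P: "((\<lambda>t. P (?c t) * cnj (P (?c t))) has_integral complex_of_real Q) {0..1}" .
  have f_f: "((\<lambda>t. (cmod (f (?c t)))\<^sup>2) has_integral integral {0..1} (\<lambda>t. (cmod (f (?c t)))\<^sup>2)) {0..1}"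
    by (intro integrable_integral integrable_norm_square_circlepath[OF f r])
  have expand: "(cmod (x - y))\<^sup>2 = (cmod x)\<^sup>2 - 2 * Re (x * cnj y) + Re (y * cnj y)" for x y
    unfolding cmod_power2 by (simp add: power2_eq_square algebra_simps)
  have Re_f_P: "((\<lambda>t. Re (f (?c t) * cnj (P (?c t)))) has_integral Q) {0..1}"
    using has_integral_linear[OF f_P bounded_linear_Re] by (simp only: o_def Re_complex_of_real)
  have Re_P_P: "((\<lambda>t. Re (P (?c t) * cnj (P (?c t)))) has_integral Q) {0..1}"
    using has_integral_linear[OF P_P bounded_linear_Re] by (simp only: o_def Re_complex_of_real)
  have "((\<lambda>t. (cmod (f (?c t) - P (?c t)))\<^sup>2) has_integral
      integral {0..1} (\<lambda>t. (cmod (f (?c t)))\<^sup>2) - 2 * Q + Q) {0..1}"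
    unfolding expand
    by (intro has_integral_add has_integral_diff has_integral_mult_right f_f Re_f_P Re_P_P)
  hence "0 \<le> integral {0..1} (\<lambda>t. (cmod (f (?c t)))\<^sup>2) - 2 * Q + Q"
    by (rule has_integral_nonneg) simp
  thus ?thesis by (simp add: Q_def)
qed

section \<open>The Hardy space\<close>

lemma H2_holomorphic: "f \<in> H2 \<Longrightarrow> f holomorphic_on unit_disk"
  by (simp add: H2_def)

lemma H2_summable: "f \<in> H2 \<Longrightarrow> summable (\<lambda>n. (cmod (taylor_coeff f n))\<^sup>2)"
  by (simp add: H2_def)

lemma h2_norm_nonneg: "f \<in> H2 \<Longrightarrow> 0 \<le> h2_norm f"
  by (simp add: h2_norm_def suminf_nonneg H2_summable)

lemma h2_norm_power2: "f \<in> H2 \<Longrightarrow> (h2_norm f)\<^sup>2 = (\<Sum>n. (cmod (taylor_coeff f n))\<^sup>2)"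
  by (simp add: h2_norm_def suminf_nonneg H2_summable)

lemma sum_taylor_coeff_le_h2_norm:
  assumes "f \<in> H2"
  shows "(\<Sum>n<m. (cmod (taylor_coeff f n))\<^sup>2) \<le> (h2_norm f)\<^sup>2"
  unfolding h2_norm_power2[OF assms] by (intro sum_le_suminf H2_summable assms) auto

lemma H2_bounded_sums:
  assumes "f holomorphic_on unit_disk" "\<And>z. z \<notin> unit_disk \<Longrightarrow> f z = 0"
    and "\<And>m. (\<Sum>n<m. (cmod (taylor_coeff f n))\<^sup>2) \<le> C\<^sup>2" and "0 \<le> C"
  shows "f \<in> H2" and "h2_norm f \<le> C"
proof -
  have s: "summable (\<lambda>n. (cmod (taylor_coeff f n))\<^sup>2)"
    by (rule summableI_nonneg_bounded[OF _ assms(3)]) simp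
  thus "f \<in> H2" using assms by (simp add: H2_def)
  have "(\<Sum>n. (cmod (taylor_coeff f n))\<^sup>2) \<le> C\<^sup>2" by (rule suminf_le_const[OF s assms(3)])
  thus "h2_norm f \<le> C" unfolding h2_norm_def using \<open>0 \<le> C\<close> by (intro real_le_lsqrt)
qed

lemma H2_cmult: "f \<in> H2 \<Longrightarrow> (\<lambda>z. c * f z) \<in> H2"
  by (auto simp: H2_def taylor_coeff_cmult norm_mult power_mult_distrib
        intro!: holomorphic_intros summable_mult)

lemma h2_norm_cmult:
  assumes "f \<in> H2"
  shows "h2_norm (\<lambda>z. c * f z) = cmod c * h2_norm f"
  using suminf_mult[OF H2_summable[OF assms], of "(cmod c)\<^sup>2"]
  by (simp add: h2_norm_def taylor_coeff_cmult H2_holomorphic assms norm_mult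
      power_mult_distrib real_sqrt_mult)

lemma H2_add:
  assumes "f \<in> H2" "g \<in> H2"
  shows "(\<lambda>z. f z + g z) \<in> H2"
proof -
  have parallelogram: "(cmod (x + y))\<^sup>2 \<le> 2 * (cmod x)\<^sup>2 + 2 * (cmod y)\<^sup>2" for x y
    using zero_le_power2[of "cmod (x - y)"] unfolding cmod_power2
    by (simp add: power2_eq_square algebra_simps)
  have "summable (\<lambda>n. 2 * (cmod (taylor_coeff f n))\<^sup>2 + 2 * (cmod (taylor_coeff g n))\<^sup>2)"
    using assms by (intro summable_add summable_mult H2_summable)
  hence "summable (\<lambda>n. (cmod (taylor_coeff f n + taylor_coeff g n))\<^sup>2)"
    by (rule summable_comparison_test'[where N = 0]) (simp add: parallelogram)
  thus ?thesis using assms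
    by (auto simp: H2_def taylor_coeff_add intro!: holomorphic_intros)
qed

lemma H2_zero: "(\<lambda>z. 0) \<in> H2"
  using taylor_coeff_polynomial[of "\<lambda>_. 0" 0] by (simp add: H2_def)

lemma H2_diff: "f \<in> H2 \<Longrightarrow> g \<in> H2 \<Longrightarrow> (\<lambda>z. f z - g z) \<in> H2"
  using H2_add[of f "\<lambda>z. - 1 * g z"] H2_cmult[of g "- 1"] by simp

lemma H2_sum: "(\<And>k. k \<in> A \<Longrightarrow> f k \<in> H2) \<Longrightarrow> (\<lambda>z. \<Sum>k\<in>A. f k z) \<in> H2"
  by (induction A rule: infinite_finite_induct) (auto intro: H2_zero H2_add)

definition disk_monomial :: "nat \<Rightarrow> complex \<Rightarrow> complex" where
  "disk_monomial k z = (if z \<in> unit_disk then z ^ k else 0)"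

lemma taylor_coeff_disk_polynomial:
  "taylor_coeff (\<lambda>z. \<Sum>k<m. c k * disk_monomial k z) n = (if n < m then c n else 0)"
  by (subst taylor_coeff_cong[where g = "\<lambda>z. \<Sum>k<m. c k * z ^ k"])
     (auto simp: disk_monomial_def taylor_coeff_polynomial)

lemma disk_monomial_H2: "disk_monomial k \<in> H2"
proof -
  have "(\<lambda>z. z ^ k) holomorphic_on unit_disk" by (intro holomorphic_intros)
  hence "disk_monomial k holomorphic_on unit_disk"
    by (rule holomorphic_transform) (simp add: disk_monomial_def)
  moreover have "taylor_coeff (disk_monomial k) n = (if n = k then 1 else 0)" for n
    using taylor_coeff_disk_polynomial[of "\<lambda>j. if j = k then 1 else 0" "Suc k" n]
    by (simp add: if_distrib[of "\<lambda>x. x * _"] cong: if_cong)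
  hence "summable (\<lambda>n. (cmod (taylor_coeff (disk_monomial k) n))\<^sup>2)"
    by (intro summable_finite[of "{k}"]) auto
  ultimately show ?thesis by (auto simp: H2_def) (simp add: disk_monomial_def)
qed

lemma disk_polynomial_H2: "(\<lambda>z. \<Sum>k\<in>A. c k * disk_monomial k z) \<in> H2"
  by (intro H2_sum H2_cmult disk_monomial_H2)

section \<open>Littlewood's subordination principle\<close>

definition disk_self_map :: "(complex \<Rightarrow> complex) \<Rightarrow> bool" where
  "disk_self_map \<psi> \<longleftrightarrow> \<psi> holomorphic_on unit_disk \<and> \<psi> ` unit_disk \<subseteq> unit_disk"

lemma disk_self_mapI:
  assumes "\<psi> holomorphic_on unit_disk" "\<And>z. cmod z < 1 \<Longrightarrow> cmod (\<psi> z) < 1"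
  shows "disk_self_map \<psi>"
  using assms by (auto simp: disk_self_map_def)

lemma disk_self_map_holomorphic: "disk_self_map \<psi> \<Longrightarrow> \<psi> holomorphic_on unit_disk"
  by (simp add: disk_self_map_def)

lemma disk_self_map_norm_less_one: "disk_self_map \<psi> \<Longrightarrow> cmod z < 1 \<Longrightarrow> cmod (\<psi> z) < 1"
  by (force simp: disk_self_map_def)

lemma holomorphic_on_compose_disk_self_map:
  assumes "f holomorphic_on unit_disk" "disk_self_map \<psi>"
  shows "(\<lambda>z. f (\<psi> z)) holomorphic_on unit_disk"
  using holomorphic_on_compose_gen[OF _ assms(1)] assms(2) by (simp add: disk_self_map_def o_def)

lemma disk_self_map_compose:
  assumes \<phi>: "disk_self_map \<phi>" and \<psi>: "disk_self_map \<psi>"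
  shows "disk_self_map (\<lambda>z. \<psi> (\<phi> z))"
proof (rule disk_self_mapI)
  show "(\<lambda>z. \<psi> (\<phi> z)) holomorphic_on unit_disk"
    by (rule holomorphic_on_compose_disk_self_map[OF disk_self_map_holomorphic[OF \<psi>] \<phi>])
qed (simp add: disk_self_map_norm_less_one \<phi> \<psi>)

lemma disk_self_map_dilation:
  assumes "0 \<le> s" "s \<le> 1"
  shows "disk_self_map (\<lambda>z. of_real s * z)"
proof (rule disk_self_mapI)
  fix z :: complex assume "cmod z < 1"
  moreover have "s * cmod z \<le> cmod z" using assms by (intro mult_left_le_one_le) auto
  ultimately show "cmod (of_real s * z) < 1" using assms by (simp add: norm_mult)
qed (intro holomorphic_intros)

definition power_tail :: "(nat \<Rightarrow> complex) \<Rightarrow> nat \<Rightarrow> nat \<Rightarrow> complex \<Rightarrow> complex" where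
  "power_tail a N n u = (\<Sum>k<N - n. a (n + k) * u ^ k)"

lemma power_tail_rec:
  assumes "n < N"
  shows "power_tail a N n u = a n + u * power_tail a N (Suc n) u"
proof -
  have "N - n = Suc (N - Suc n)" using assms by simp
  thus ?thesis
    by (simp add: power_tail_def sum.lessThan_Suc_shift sum_distrib_left algebra_simps
        del: sum.lessThan_Suc)
qed

lemma power_tail_at_end [simp]: "power_tail a N N u = 0"
  by (simp add: power_tail_def)

text \<open>Its real part is the Poisson extension of the restriction of \<open>\<bar>\<Sum>k<N. a k * u ^ k\<bar>\<^sup>2\<close> to the
  unit circle.\<close>

definition herglotz_polynomial :: "(nat \<Rightarrow> complex) \<Rightarrow> nat \<Rightarrow> complex \<Rightarrow> complex" where
  "herglotz_polynomial a N u = (\<Sum>n<N. (power_tail a N n u + u * power_tail a N (Suc n) u) * cnj (a n))"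

lemma herglotz_polynomial_holomorphic: "herglotz_polynomial a N holomorphic_on A"
  unfolding herglotz_polynomial_def[abs_def] power_tail_def by (intro holomorphic_intros)

lemma Re_herglotz_polynomial:
  "Re (herglotz_polynomial a N u)
     = (\<Sum>n<N. (cmod (power_tail a N n u))\<^sup>2 - (cmod u)\<^sup>2 * (cmod (power_tail a N (Suc n) u))\<^sup>2)"
proof -
  have polarization: "Re ((x + y) * cnj (x - y)) = (cmod x)\<^sup>2 - (cmod y)\<^sup>2" for x y
    unfolding cmod_power2 by (simp add: power2_eq_square algebra_simps)
  have "Re ((power_tail a N n u + u * power_tail a N (Suc n) u) * cnj (a n))
      = (cmod (power_tail a N n u))\<^sup>2 - (cmod u)\<^sup>2 * (cmod (power_tail a N (Suc n) u))\<^sup>2"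
          if "n < N" for n
  proof -
    have "a n = power_tail a N n u - u * power_tail a N (Suc n) u"
      using power_tail_rec[OF that, of a u] by simp
    thus ?thesis by (simp only: polarization norm_mult power_mult_distrib)
  qed
  thus ?thesis by (simp add: herglotz_polynomial_def)
qed

lemma norm_polynomial_le_Re_herglotz:
  assumes "cmod u \<le> 1"
  shows "(cmod (\<Sum>k<N. a k * u ^ k))\<^sup>2 \<le> Re (herglotz_polynomial a N u)"
proof -
  have "(cmod (\<Sum>k<N. a k * u ^ k))\<^sup>2 = (cmod (power_tail a N 0 u))\<^sup>2" by (simp add: power_tail_def)
  also have "\<dots> = (\<Sum>n<N. (cmod (power_tail a N n u))\<^sup>2 - (cmod (power_tail a N (Suc n) u))\<^sup>2)"
    by (subst sum_lessThan_telescope') simp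
  also have "\<dots> \<le> Re (herglotz_polynomial a N u)"
    unfolding Re_herglotz_polynomial using assms
    by (intro sum_mono diff_left_mono mult_left_le_one_le) (auto simp: power_le_one)
  finally show ?thesis .
qed

lemma norm_add_mult_power2_le:
  fixes x y u :: complex
  assumes "cmod u < 1"
  shows "(cmod (x + u * y))\<^sup>2 \<le> (cmod x)\<^sup>2 / (1 - cmod u) + cmod u * (cmod y)\<^sup>2"
proof -
  define q X Y where "q = cmod u" and "X = cmod x" and "Y = cmod y"
  have q: "0 \<le> q" "q < 1" using assms by (auto simp: q_def)
  have "cmod (x + u * y) \<le> X + q * Y"
    unfolding q_def X_def Y_def by (rule order_trans[OF norm_triangle_ineq]) (simp add: norm_mult)
  hence "(cmod (x + u * y))\<^sup>2 \<le> (X + q * Y)\<^sup>2" by (rule power_mono) simp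
  also have "\<dots> \<le> X\<^sup>2 / (1 - q) + q * Y\<^sup>2"
  proof -
    have "X\<^sup>2 + q * Y\<^sup>2 * (1 - q) - (X + q * Y)\<^sup>2 * (1 - q) = q * (X - (1 - q) * Y)\<^sup>2"
      by algebra
    moreover have "\<dots> \<ge> 0" using q by simp
    ultimately show ?thesis using q by (simp add: field_simps)
  qed
  finally show ?thesis by (simp add: q_def X_def Y_def)
qed

lemma sum_norm_power_tail_le:
  assumes u: "cmod u < 1"
  shows "(\<Sum>n<N. (cmod (power_tail a N n u))\<^sup>2) \<le> (\<Sum>n<N. (cmod (a n))\<^sup>2) / (1 - cmod u)\<^sup>2"
proof -
  define T where "T = (\<lambda>n. (cmod (power_tail a N n u))\<^sup>2)"
  define A where "A = (\<Sum>n<N. (cmod (a n))\<^sup>2)"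
  have "(\<Sum>n<N. T n) \<le> (\<Sum>n<N. (cmod (a n))\<^sup>2 / (1 - cmod u) + cmod u * T (Suc n))"
    unfolding T_def by (intro sum_mono) (simp add: power_tail_rec norm_add_mult_power2_le u)
  also have "\<dots> = A / (1 - cmod u) + cmod u * (\<Sum>n<N. T (Suc n))"
    by (simp add: A_def sum.distrib sum_divide_distrib sum_distrib_left)
  also have "\<dots> \<le> A / (1 - cmod u) + cmod u * (\<Sum>n<N. T n)"
  proof (intro add_left_mono mult_left_mono)
    have "(\<Sum>n<N. T (Suc n)) - (\<Sum>n<N. T n) = - T 0"
      unfolding sum_subtractf[symmetric] sum_lessThan_telescope by (simp add: T_def)
    moreover have "0 \<le> T 0" by (simp add: T_def)
    ultimately show "(\<Sum>n<N. T (Suc n)) \<le> (\<Sum>n<N. T n)" by linarith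
  qed simp
  finally have "(\<Sum>n<N. T n) * (1 - cmod u) \<le> A / (1 - cmod u)" by (simp add: algebra_simps)
  thus ?thesis using u by (simp add: pos_le_divide_eq power2_eq_square mult.assoc T_def A_def)
qed

lemma Re_herglotz_le:
  assumes "cmod u < 1"
  shows "Re (herglotz_polynomial a N u) \<le> (\<Sum>k<N. (cmod (a k))\<^sup>2) / (1 - cmod u)\<^sup>2"
proof -
  have "Re (herglotz_polynomial a N u) \<le> (\<Sum>n<N. (cmod (power_tail a N n u))\<^sup>2)"
    unfolding Re_herglotz_polynomial by (intro sum_mono) simp
  thus ?thesis using sum_norm_power_tail_le[OF assms, of a N] by linarith
qed

lemma littlewood_polynomial:
  assumes \<psi>: "disk_self_map \<psi>"
  shows "(\<Sum>n<m. (cmod (taylor_coeff (\<lambda>z. \<Sum>k<N. a k * \<psi> z ^ k) n))\<^sup>2)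
           \<le> (\<Sum>k<N. (cmod (a k))\<^sup>2) / (1 - cmod (\<psi> 0))\<^sup>2"
proof -
  define h where "h = (\<lambda>z. \<Sum>k<N. a k * \<psi> z ^ k)"
  have h: "h holomorphic_on unit_disk"
    unfolding h_def by (intro holomorphic_intros disk_self_map_holomorphic[OF \<psi>])
  define F where "F = (\<lambda>z. herglotz_polynomial a N (\<psi> z))"
  have F: "F holomorphic_on unit_disk"
    unfolding F_def
    by (intro holomorphic_on_compose_disk_self_map[OF _ \<psi>] herglotz_polynomial_holomorphic)
  have weighted: "(\<Sum>n<m. (cmod (taylor_coeff h n))\<^sup>2 * r ^ (2 * n)) \<le> Re (F 0)"
      if r: "0 < r" "r < 1" for r
  proof -
    have "(\<Sum>n<m. (cmod (taylor_coeff h n))\<^sup>2 * r ^ (2 * n))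
        \<le> integral {0..1} (\<lambda>t. (cmod (h (circlepath 0 r t)))\<^sup>2)"
      by (rule bessel_inequality_circlepath[OF h r])
    also have "\<dots> \<le> Re (F 0)"
    proof (rule has_integral_le[OF integrable_integral[OF integrable_norm_square_circlepath[OF h r]]])
      show "((\<lambda>t. Re (F (circlepath 0 r t))) has_integral Re (F 0)) {0..1}"
        by (rule circlepath_mean_value_Re[OF F r])
      show "(cmod (h (circlepath 0 r t)))\<^sup>2 \<le> Re (F (circlepath 0 r t))" for t
        using disk_self_map_norm_less_one[OF \<psi>, of "circlepath 0 r t"] r
        unfolding h_def F_def by (intro norm_polynomial_le_Re_herglotz) simp
    qed
    finally show ?thesis .
  qed
  have "((\<lambda>r. \<Sum>n<m. (cmod (taylor_coeff h n))\<^sup>2 * r ^ (2 * n)) \<longlongrightarrow>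
          (\<Sum>n<m. (cmod (taylor_coeff h n))\<^sup>2 * 1 ^ (2 * n))) (at_left 1)"
    by (intro tendsto_intros)
  moreover have "\<forall>\<^sub>F r in at_left 1. (\<Sum>n<m. (cmod (taylor_coeff h n))\<^sup>2 * r ^ (2 * n)) \<le> Re (F 0)"
    using weighted by (intro eventually_at_leftI[of 0]) auto
  ultimately have "(\<Sum>n<m. (cmod (taylor_coeff h n))\<^sup>2) \<le> Re (F 0)"
    using tendsto_upperbound[OF _ _ trivial_limit_at_left_real] by fastforce
  also have "\<dots> \<le> (\<Sum>k<N. (cmod (a k))\<^sup>2) / (1 - cmod (\<psi> 0))\<^sup>2"
    unfolding F_def by (intro Re_herglotz_le disk_self_map_norm_less_one[OF \<psi>]) simp
  finally show ?thesis by (simp add: h_def)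
qed

lemma taylor_coeff_polynomial_compose_tendsto:
  assumes \<psi>: "disk_self_map \<psi>" and f: "f holomorphic_on unit_disk"
  shows "(\<lambda>N. taylor_coeff (\<lambda>z. \<Sum>k<N. taylor_coeff f k * \<psi> z ^ k) n)
           \<longlonglongrightarrow> taylor_coeff (comp_op \<psi> f) n"
proof -
  define \<rho> where "\<rho> = (1 + cmod (\<psi> 0)) / 2"
  have \<rho>: "cmod (\<psi> 0) < \<rho>" "0 \<le> \<rho>" "\<rho> < 1"
    using disk_self_map_norm_less_one[OF \<psi>, of 0] by (simp_all add: \<rho>_def)
  define A where "A = unit_disk \<inter> \<psi> -` ball 0 \<rho>"
  have "open A"
    unfolding A_def using disk_self_map_holomorphic[OF \<psi>]
    by (intro continuous_open_preimage holomorphic_on_imp_continuous_on) auto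
  have "0 \<in> A" using \<rho> by (simp add: A_def)
  have "uniform_limit A (\<lambda>N z. \<Sum>k<N. taylor_coeff f k * \<psi> z ^ k) (\<lambda>z. f (\<psi> z)) sequentially"
    by (rule uniform_limit_compose'[OF uniform_limit_taylor_polynomials[OF f \<rho>(2,3)]])
       (auto simp: A_def)
  also have "?this \<longleftrightarrow>
      uniform_limit A (\<lambda>N z. \<Sum>k<N. taylor_coeff f k * \<psi> z ^ k) (comp_op \<psi> f) sequentially"
    by (intro uniform_limit_cong) (auto simp: A_def comp_op_def)
  finally have limit:
    "uniform_limit A (\<lambda>N z. \<Sum>k<N. taylor_coeff f k * \<psi> z ^ k) (comp_op \<psi> f) sequentially" .
  have "(\<lambda>z. \<Sum>k<N. taylor_coeff f k * \<psi> z ^ k) holomorphic_on A" for N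
    using holomorphic_on_subset[OF disk_self_map_holomorphic[OF \<psi>], of A]
    by (intro holomorphic_intros) (auto simp: A_def)
  thus ?thesis
    unfolding taylor_coeff_def[of _ n]
    by (intro tendsto_divide tendsto_const higher_deriv_complex_uniform_limit[OF limit]
        always_eventually allI)
       (use \<open>open A\<close> \<open>0 \<in> A\<close> in auto)
qed

proposition littlewood_subordination:
  assumes \<psi>: "disk_self_map \<psi>" and f: "f \<in> H2"
  shows comp_op_H2: "comp_op \<psi> f \<in> H2"
    and h2_norm_comp_op_le: "h2_norm (comp_op \<psi> f) \<le> h2_norm f / (1 - cmod (\<psi> 0))"
proof -
  define C where "C = h2_norm f / (1 - cmod (\<psi> 0))"
  have "comp_op \<psi> f holomorphic_on unit_disk"
    using holomorphic_on_compose_disk_self_map[OF H2_holomorphic[OF f] \<psi>]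
    by (rule holomorphic_transform) (simp add: comp_op_def)
  moreover have "comp_op \<psi> f z = 0" if "z \<notin> unit_disk" for z using that by (simp add: comp_op_def)
  moreover have "(\<Sum>n<m. (cmod (taylor_coeff (comp_op \<psi> f) n))\<^sup>2) \<le> C\<^sup>2" for m
  proof (rule tendsto_upperbound)
    let ?P = "\<lambda>N z. \<Sum>k<N. taylor_coeff f k * \<psi> z ^ k"
    show "(\<lambda>N. \<Sum>n<m. (cmod (taylor_coeff (?P N) n))\<^sup>2)
            \<longlonglongrightarrow> (\<Sum>n<m. (cmod (taylor_coeff (comp_op \<psi> f) n))\<^sup>2)"
      by (intro tendsto_intros taylor_coeff_polynomial_compose_tendsto \<psi> H2_holomorphic f)
    have "(\<Sum>n<m. (cmod (taylor_coeff (?P N) n))\<^sup>2) \<le> C\<^sup>2" for N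
    proof -
      have "(\<Sum>n<m. (cmod (taylor_coeff (?P N) n))\<^sup>2)
          \<le> (\<Sum>k<N. (cmod (taylor_coeff f k))\<^sup>2) / (1 - cmod (\<psi> 0))\<^sup>2"
        by (rule littlewood_polynomial[OF \<psi>])
      also have "\<dots> \<le> (h2_norm f)\<^sup>2 / (1 - cmod (\<psi> 0))\<^sup>2"
        by (intro divide_right_mono sum_taylor_coeff_le_h2_norm f) auto
      finally show ?thesis by (simp add: C_def power_divide)
    qed
    thus "\<forall>\<^sub>F N in sequentially. (\<Sum>n<m. (cmod (taylor_coeff (?P N) n))\<^sup>2) \<le> C\<^sup>2" by simp
  qed simp
  moreover have "0 \<le> C"
    using disk_self_map_norm_less_one[OF \<psi>, of 0] h2_norm_nonneg[OF f] by (simp add: C_def)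
  ultimately show "comp_op \<psi> f \<in> H2" and "h2_norm (comp_op \<psi> f) \<le> h2_norm f / (1 - cmod (\<psi> 0))"
    using H2_bounded_sums[of "comp_op \<psi> f" C] by (auto simp: C_def)
qed

section \<open>Approximation numbers of composition operators\<close>

lemma h2_linear_op_H2: "h2_linear_op R \<Longrightarrow> f \<in> H2 \<Longrightarrow> R f \<in> H2"
  by (simp add: h2_linear_op_def)

lemma h2_linear_op_add:
  "h2_linear_op R \<Longrightarrow> f \<in> H2 \<Longrightarrow> g \<in> H2 \<Longrightarrow> R (\<lambda>z. f z + g z) = (\<lambda>z. R f z + R g z)"
  by (simp add: h2_linear_op_def)

lemma h2_linear_op_cmult: "h2_linear_op R \<Longrightarrow> f \<in> H2 \<Longrightarrow> R (\<lambda>z. c * f z) = (\<lambda>z. c * R f z)"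
  by (simp add: h2_linear_op_def)

lemma h2_linear_op_sum:
  assumes R: "h2_linear_op R" and "finite A" "\<And>k. k \<in> A \<Longrightarrow> f k \<in> H2"
  shows "R (\<lambda>z. \<Sum>k\<in>A. c k * f k z) = (\<lambda>z. \<Sum>k\<in>A. c k * R (f k) z)"
  using assms(2,3)
proof (induction A rule: finite_induct)
  case empty
  show ?case using h2_linear_op_cmult[OF R H2_zero, of 0] by simp
next
  case (insert k A)
  thus ?case
    using h2_linear_op_add[OF R, of "\<lambda>z. c k * f k z" "\<lambda>z. \<Sum>k\<in>A. c k * f k z"]
    by (simp add: H2_sum H2_cmult h2_linear_op_cmult[OF R])
qed

lemma h2_linear_op_diff:
  assumes "h2_linear_op T" "h2_linear_op R"
  shows "h2_linear_op (\<lambda>f z. T f z - R f z)"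
  using assms by (simp add: h2_linear_op_def H2_diff fun_eq_iff algebra_simps)

lemma h2_linear_op_comp_op:
  assumes "disk_self_map \<psi>"
  shows "h2_linear_op (comp_op \<psi>)"
  using comp_op_H2[OF assms] by (auto simp: h2_linear_op_def comp_op_def)

lemma h2_linear_op_compose: "h2_linear_op S \<Longrightarrow> h2_linear_op T \<Longrightarrow> h2_linear_op (\<lambda>f. S (T f))"
  by (simp add: h2_linear_op_def)

lemma h2_norm_le_h2_opnorm:
  assumes T: "h2_linear_op T" and f: "f \<in> H2" "h2_norm f \<le> C" and C: "0 < C"
  shows "ereal (h2_norm (T f)) \<le> ereal C * h2_opnorm T"
proof -
  define g where "g = (\<lambda>z. of_real (1 / C) * f z)"
  have g: "g \<in> H2" "h2_norm g \<le> 1"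
    unfolding g_def h2_norm_cmult[OF f(1)] using f C by (intro H2_cmult, simp_all add: norm_divide)
  have "T f = (\<lambda>z. of_real C * T g z)"
    using C h2_linear_op_cmult[OF T g(1), of "of_real C"] by (simp add: g_def)
  hence "ereal (h2_norm (T f)) = ereal C * ereal (h2_norm (T g))"
    using C h2_linear_op_H2[OF T g(1)] by (simp add: h2_norm_cmult)
  also have "\<dots> \<le> ereal C * h2_opnorm T"
    unfolding h2_opnorm_def using g C by (intro ereal_mult_left_mono SUP_upper) auto
  finally show ?thesis .
qed

lemma h2_opnorm_nonneg:
  assumes "h2_linear_op T"
  shows "0 \<le> h2_opnorm T"
proof -
  have "0 \<le> ereal (h2_norm (T (\<lambda>z. 0)))"
    using h2_norm_nonneg[OF h2_linear_op_H2[OF assms H2_zero]] by simp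
  also have "h2_norm (\<lambda>z. 0) = 0" using h2_norm_cmult[OF H2_zero, of 0] by simp
  hence "ereal (h2_norm (T (\<lambda>z. 0))) \<le> h2_opnorm T"
    unfolding h2_opnorm_def using H2_zero by (intro SUP_upper) auto
  finally show ?thesis .
qed

lemma approx_num_ext_nonneg: "h2_linear_op T \<Longrightarrow> 0 \<le> approx_num_ext T n"
  unfolding approx_num_ext_def by (intro INF_greatest h2_opnorm_nonneg h2_linear_op_diff) auto

lemma approx_num_ext_le:
  assumes "h2_linear_op R" "rank_less R n"
  shows "approx_num_ext T n \<le> h2_opnorm (\<lambda>f z. T f z - R f z)"
  unfolding approx_num_ext_def using assms by (intro INF_lower) auto

lemma rank_lessI:
  assumes K: "finite K" "card K < n" and R: "\<And>f. f \<in> H2 \<Longrightarrow> R f = (\<lambda>z. \<Sum>k\<in>K. c f k * v k z)"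
  shows "rank_less R n"
  unfolding rank_less_def
proof (intro exI[of _ "v ` K"] conjI ballI)
  show "card (v ` K) < n" using card_image_le[of K v] K by simp
  fix f assume "f \<in> H2"
  let ?d = "\<lambda>b. \<Sum>k | k \<in> K \<and> v k = b. c f k"
  have "R f z = (\<Sum>b\<in>v ` K. ?d b * b z)" for z
    using sum.image_gen[OF K(1), of "\<lambda>k. c f k * v k z" v]
    by (simp add: R \<open>f \<in> H2\<close> sum_distrib_right)
  thus "\<exists>d. R f = (\<lambda>z. \<Sum>b\<in>v ` K. d b * b z)" by (intro exI[of _ ?d] ext)
qed (use K in simp)

lemma rank_less_comp_op_sandwich:
  assumes R: "rank_less R n" and \<psi>: "disk_self_map \<psi>"
  shows "rank_less (\<lambda>f. comp_op \<tau> (R (comp_op \<psi> f))) n"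
proof -
  obtain B where B: "finite B" "card B < n" "\<forall>f\<in>H2. \<exists>c. R f = (\<lambda>z. \<Sum>b\<in>B. c b * b z)"
    using R by (auto simp: rank_less_def)
  then obtain c where c: "\<And>f. f \<in> H2 \<Longrightarrow> R f = (\<lambda>z. \<Sum>b\<in>B. c f b * b z)" by metis
  show ?thesis
  proof (rule rank_lessI[OF B(1,2)])
    fix f assume "f \<in> H2"
    hence "R (comp_op \<psi> f) = (\<lambda>z. \<Sum>b\<in>B. c (comp_op \<psi> f) b * b z)" by (intro c comp_op_H2[OF \<psi>])
    thus "comp_op \<tau> (R (comp_op \<psi> f)) = (\<lambda>z. \<Sum>b\<in>B. c (comp_op \<psi> f) b * comp_op \<tau> b z)"
      by (auto simp: comp_op_def)
  qed
qed

lemma h2_norm_comp_op_le_of_unit: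
  assumes \<psi>: "disk_self_map \<psi>" and f: "f \<in> H2" "h2_norm f \<le> 1"
  shows "h2_norm (comp_op \<psi> f) \<le> 1 / (1 - cmod (\<psi> 0))"
proof -
  have "h2_norm (comp_op \<psi> f) \<le> h2_norm f / (1 - cmod (\<psi> 0))" by (rule h2_norm_comp_op_le[OF \<psi> f(1)])
  also have "\<dots> \<le> 1 / (1 - cmod (\<psi> 0))"
    using f(2) disk_self_map_norm_less_one[OF \<psi>, of 0] by (intro divide_right_mono) auto
  finally show ?thesis .
qed

lemma h2_opnorm_comp_op_sandwich:
  assumes T: "h2_linear_op T" and \<tau>: "disk_self_map \<tau>" and \<psi>: "disk_self_map \<psi>"
  shows "h2_opnorm (\<lambda>f. comp_op \<tau> (T (comp_op \<psi> f)))
           \<le> ereal (1 / ((1 - cmod (\<tau> 0)) * (1 - cmod (\<psi> 0)))) * h2_opnorm T"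
    (is "_ \<le> ereal ?C * _")
  unfolding h2_opnorm_def[of "\<lambda>f. comp_op \<tau> (T (comp_op \<psi> f))"]
proof (intro SUP_least, clarify)
  have pos: "0 < 1 - cmod (\<tau> 0)" "0 < 1 - cmod (\<psi> 0)"
    using disk_self_map_norm_less_one[of _ 0] \<tau> \<psi> by auto
  fix f assume f: "f \<in> H2" "h2_norm f \<le> 1"
  have \<psi>f: "comp_op \<psi> f \<in> H2" by (rule comp_op_H2[OF \<psi> f(1)])
  have T_bound: "ereal (h2_norm (T (comp_op \<psi> f))) \<le> ereal (1 / (1 - cmod (\<psi> 0))) * h2_opnorm T"
    using pos by (intro h2_norm_le_h2_opnorm T \<psi>f h2_norm_comp_op_le_of_unit \<psi> f) auto
  have "ereal (h2_norm (comp_op \<tau> (T (comp_op \<psi> f))))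
      \<le> ereal (1 / (1 - cmod (\<tau> 0))) * ereal (h2_norm (T (comp_op \<psi> f)))"
    using h2_norm_comp_op_le[OF \<tau> h2_linear_op_H2[OF T \<psi>f]] by simp
  also have "\<dots> \<le> ereal (1 / (1 - cmod (\<tau> 0))) * (ereal (1 / (1 - cmod (\<psi> 0))) * h2_opnorm T)"
    using pos by (intro ereal_mult_left_mono T_bound) auto
  also have "\<dots> = ereal ?C * h2_opnorm T" by (simp flip: mult.assoc)
  finally show "ereal (h2_norm (comp_op \<tau> (T (comp_op \<psi> f)))) \<le> ereal ?C * h2_opnorm T" .
qed

proposition approx_num_ext_comp_op_sandwich:
  assumes T: "h2_linear_op T" and \<tau>: "disk_self_map \<tau>" and \<psi>: "disk_self_map \<psi>"
  shows "approx_num_ext (\<lambda>f. comp_op \<tau> (T (comp_op \<psi> f))) n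
           \<le> ereal (1 / ((1 - cmod (\<tau> 0)) * (1 - cmod (\<psi> 0)))) * approx_num_ext T n"
    (is "?lhs \<le> ereal ?C * _")
proof -
  have pos: "0 < ?C"
    using disk_self_map_norm_less_one[of _ 0] \<tau> \<psi> by simp
  have "?lhs \<le> ereal ?C * h2_opnorm (\<lambda>f z. T f z - R f z)" if R: "h2_linear_op R" "rank_less R n" for R
  proof -
    define D where "D = (\<lambda>f z. T f z - R f z)"
    have D: "h2_linear_op D" unfolding D_def by (rule h2_linear_op_diff[OF T R(1)])
    have "h2_linear_op (\<lambda>f. comp_op \<tau> (R (comp_op \<psi> f)))"
      by (rule h2_linear_op_compose[OF h2_linear_op_comp_op[OF \<tau>]
            h2_linear_op_compose[OF R(1) h2_linear_op_comp_op[OF \<psi>]]])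
    hence "?lhs \<le> h2_opnorm (\<lambda>f z. comp_op \<tau> (T (comp_op \<psi> f)) z - comp_op \<tau> (R (comp_op \<psi> f)) z)"
      by (rule approx_num_ext_le) (rule rank_less_comp_op_sandwich[OF R(2) \<psi>])
    also have "\<dots> = h2_opnorm (\<lambda>f. comp_op \<tau> (D (comp_op \<psi> f)))"
      by (rule arg_cong[of _ _ h2_opnorm]) (auto simp: D_def comp_op_def fun_eq_iff)
    also have "\<dots> \<le> ereal ?C * h2_opnorm D" by (rule h2_opnorm_comp_op_sandwich[OF D \<tau> \<psi>])
    finally show ?thesis by (simp add: D_def)
  qed
  hence "?lhs / ereal ?C \<le> approx_num_ext T n"
    unfolding approx_num_ext_def[of T] using pos
    by (intro INF_greatest) (subst ereal_divide_le_pos, auto)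
  thus ?thesis using pos by (subst (asm) ereal_divide_le_pos) auto
qed

lemma comp_op_cong: "(\<And>z. z \<in> unit_disk \<Longrightarrow> \<phi> z = \<psi> z) \<Longrightarrow> comp_op \<phi> = comp_op \<psi>"
  by (auto simp: comp_op_def fun_eq_iff)

lemma comp_op_compose:
  assumes "disk_self_map \<tau>"
  shows "comp_op \<tau> (comp_op \<phi> f) = comp_op (\<lambda>z. \<phi> (\<tau> z)) f"
  using disk_self_map_norm_less_one[OF assms] by (auto simp: comp_op_def)

lemma ereal_approx_num_comp_op:
  assumes \<phi>: "disk_self_map \<phi>" and n: "0 < n"
  shows "ereal (approx_num (comp_op \<phi>) n) = approx_num_ext (comp_op \<phi>) n"
proof -
  have "approx_num_ext (comp_op \<phi>) n \<le> h2_opnorm (\<lambda>f z. comp_op \<phi> f z - 0)"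
    using n by (intro approx_num_ext_le rank_lessI[of "{}"]) (auto simp: h2_linear_op_def H2_zero)
  also have "\<dots> \<le> ereal (1 / (1 - cmod (\<phi> 0)))"
    unfolding h2_opnorm_def
  proof (intro SUP_least, clarify)
    fix f assume "f \<in> H2" "h2_norm f \<le> 1"
    thus "ereal (h2_norm (\<lambda>z. comp_op \<phi> f z - 0)) \<le> ereal (1 / (1 - cmod (\<phi> 0)))"
      using h2_norm_comp_op_le_of_unit[OF \<phi>] by simp
  qed
  finally have "approx_num_ext (comp_op \<phi>) n \<noteq> \<infinity>" by auto
  moreover have "0 \<le> approx_num_ext (comp_op \<phi>) n"
    by (intro approx_num_ext_nonneg h2_linear_op_comp_op \<phi>)
  ultimately show ?thesis
    unfolding approx_num_def by (cases "approx_num_ext (comp_op \<phi>) n") auto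
qed

corollary approx_num_comp_op_compose_le:
  assumes \<phi>: "disk_self_map \<phi>" and \<tau>: "disk_self_map \<tau>" and \<psi>: "disk_self_map \<psi>" and n: "0 < n"
  shows "approx_num (comp_op (\<lambda>z. \<psi> (\<phi> (\<tau> z)))) n
           \<le> 1 / ((1 - cmod (\<tau> 0)) * (1 - cmod (\<psi> 0))) * approx_num (comp_op \<phi>) n"
proof -
  have "comp_op (\<lambda>z. \<psi> (\<phi> (\<tau> z))) = (\<lambda>f. comp_op \<tau> (comp_op \<phi> (comp_op \<psi> f)))"
    by (simp add: comp_op_compose \<phi> \<tau> fun_eq_iff)
  hence "approx_num_ext (comp_op (\<lambda>z. \<psi> (\<phi> (\<tau> z)))) n
      \<le> ereal (1 / ((1 - cmod (\<tau> 0)) * (1 - cmod (\<psi> 0)))) * approx_num_ext (comp_op \<phi>) n"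
    using approx_num_ext_comp_op_sandwich[OF h2_linear_op_comp_op[OF \<phi>] \<tau> \<psi>] by simp
  moreover have "disk_self_map (\<lambda>z. \<psi> (\<phi> (\<tau> z)))"
    using disk_self_map_compose[OF disk_self_map_compose[OF \<tau> \<phi>] \<psi>] .
  ultimately show ?thesis
    by (simp add: n \<phi> ereal_approx_num_comp_op[symmetric])
qed

lemma (in vector_space) finite_family_dependent:
  assumes K: "finite K" and B: "finite B" "card B < card K" "v ` K \<subseteq> span B"
  obtains x where "(\<Sum>k\<in>K. scale (x k) (v k)) = 0" "\<exists>k\<in>K. x k \<noteq> 0"
proof (cases "inj_on v K")
  case True
  hence "card B < card (v ` K)" using B by (simp add: card_image)
  hence "dependent (v ` K)" using independent_span_bound[OF B(1) _ B(3)] by auto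
  then obtain u where "\<exists>w\<in>v ` K. u w \<noteq> 0" "(\<Sum>w\<in>v ` K. scale (u w) w) = 0"
    using K by (auto simp: dependent_finite)
  thus thesis using that[of "\<lambda>k. u (v k)"] by (simp add: sum.reindex[OF True])
next
  case False
  then obtain i j where ij: "i \<in> K" "j \<in> K" "i \<noteq> j" "v i = v j" by (auto simp: inj_on_def)
  define x where "x = (\<lambda>k. if k = i then 1 else if k = j then - 1 else 0 :: 'a)"
  have "(\<Sum>k\<in>K. scale (x k) (v k)) = (\<Sum>k\<in>{i, j}. scale (x k) (v k))"
    using K ij by (intro sum.mono_neutral_right) (auto simp: x_def)
  also have "\<dots> = 0" using ij by (simp add: x_def)
  finally have "(\<Sum>k\<in>K. scale (x k) (v k)) = 0" .
  moreover have "x i \<noteq> 0" by (simp add: x_def)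
  ultimately show thesis using that ij(1) by blast
qed

lemma sum_fun_apply: "(\<Sum>k\<in>K. f k) z = (\<Sum>k\<in>K. f k z :: 'a :: comm_monoid_add)"
  by (induction K rule: infinite_finite_induct) auto

lemma rank_less_nontrivial_kernel:
  assumes R: "h2_linear_op R" "rank_less R (card K)"
    and K: "finite K" "\<And>k. k \<in> K \<Longrightarrow> v k \<in> H2"
  obtains x where "\<exists>k\<in>K. x k \<noteq> 0" "R (\<lambda>z. \<Sum>k\<in>K. x k * v k z) = (\<lambda>z. 0)"
proof -
  interpret fun_space: vector_space "\<lambda>c f z. c * f z :: complex"
    by unfold_locales (auto simp: algebra_simps)
  obtain B where B: "finite B" "card B < card K" "\<forall>f\<in>H2. \<exists>c. R f = (\<lambda>z. \<Sum>b\<in>B. c b * b z)"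
    using R by (auto simp: rank_less_def)
  have "R (v k) \<in> fun_space.span B" if k: "k \<in> K" for k
  proof -
    obtain c where "R (v k) = (\<lambda>z. \<Sum>b\<in>B. c b * b z)" using B(3) K(2)[OF k] by blast
    also have "\<dots> = (\<Sum>b\<in>B. (\<lambda>z. c b * b z))" by (simp add: sum_fun_apply fun_eq_iff)
    also have "\<dots> \<in> fun_space.span B"
      by (intro fun_space.span_sum fun_space.span_scale fun_space.span_base)
    finally show ?thesis .
  qed
  then obtain x where x: "(\<Sum>k\<in>K. (\<lambda>z. x k * R (v k) z)) = 0" "\<exists>k\<in>K. x k \<noteq> 0"
    using fun_space.finite_family_dependent[OF K(1) B(1,2), of "\<lambda>k. R (v k)"] by blast
  moreover have "R (\<lambda>z. \<Sum>k\<in>K. x k * v k z) = (\<Sum>k\<in>K. (\<lambda>z. x k * R (v k) z))"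
    by (simp add: h2_linear_op_sum[OF R(1) K] sum_fun_apply fun_eq_iff)
  ultimately show thesis using that by (simp add: zero_fun_def)
qed

lemma taylor_coeff_comp_op_dilation:
  assumes "f \<in> H2" "0 \<le> s" "s \<le> 1"
  shows "taylor_coeff (comp_op (\<lambda>z. of_real s * z) f) k = of_real (s ^ k) * taylor_coeff f k"
proof -
  have "taylor_coeff (comp_op (\<lambda>z. of_real s * z) f) k = taylor_coeff (\<lambda>z. f (of_real s * z)) k"
    by (rule taylor_coeff_cong) (simp add: comp_op_def)
  thus ?thesis using assms by (simp add: taylor_coeff_dilation H2_holomorphic)
qed

lemma approx_num_ext_dilation_le:
  assumes s: "0 \<le> s" "s \<le> 1"
  shows "approx_num_ext (comp_op (\<lambda>z. of_real s * z)) (Suc m) \<le> ereal (s ^ m)"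
proof -
  let ?T = "comp_op (\<lambda>z. of_real s * z)"
  define R where "R = (\<lambda>f z. \<Sum>k<m. of_real (s ^ k) * taylor_coeff f k * disk_monomial k z)"
  have R_H2: "R f \<in> H2" for f unfolding R_def by (rule disk_polynomial_H2)
  hence "h2_linear_op R"
    by (simp add: h2_linear_op_def) (simp add: R_def taylor_coeff_add taylor_coeff_cmult
          H2_holomorphic sum.distrib sum_distrib_left algebra_simps)
  hence "approx_num_ext ?T (Suc m) \<le> h2_opnorm (\<lambda>f z. ?T f z - R f z)"
    by (rule approx_num_ext_le) (rule rank_lessI[of "{..<m}"], auto simp: R_def)
  also have "\<dots> \<le> ereal (s ^ m)"
    unfolding h2_opnorm_def
  proof (intro SUP_least, clarify)
    fix f assume f: "f \<in> H2" "h2_norm f \<le> 1"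
    define g where "g = (\<lambda>z. ?T f z - R f z)"
    have Tf: "?T f \<in> H2" by (intro comp_op_H2 disk_self_map_dilation s f)
    have g: "g \<in> H2" unfolding g_def by (rule H2_diff[OF Tf R_H2])
    have coeff: "taylor_coeff g k = (if k < m then 0 else of_real (s ^ k) * taylor_coeff f k)" for k
    proof -
      have "taylor_coeff g k = taylor_coeff (?T f) k - taylor_coeff (R f) k"
        unfolding g_def by (intro taylor_coeff_diff H2_holomorphic Tf R_H2)
      thus ?thesis using f s
        by (simp add: taylor_coeff_comp_op_dilation R_def taylor_coeff_disk_polynomial)
    qed
    have "(cmod (taylor_coeff g k))\<^sup>2 \<le> (s ^ m)\<^sup>2 * (cmod (taylor_coeff f k))\<^sup>2" for k
      using s by (cases "k < m")
        (auto simp: coeff norm_mult norm_power power_mult_distrib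
            intro!: mult_right_mono power_mono power_decreasing)
    hence "(\<Sum>k<n. (cmod (taylor_coeff g k))\<^sup>2) \<le> (s ^ m)\<^sup>2 * (\<Sum>k<n. (cmod (taylor_coeff f k))\<^sup>2)" for n
      unfolding sum_distrib_left by (intro sum_mono)
    also have "\<dots> n \<le> (s ^ m)\<^sup>2 * 1" for n
      using sum_taylor_coeff_le_h2_norm[OF f(1), of n] power_mono[OF f(2) h2_norm_nonneg[OF f(1)], of 2]
      by (intro mult_left_mono) auto
    finally have "(\<Sum>k<n. (cmod (taylor_coeff g k))\<^sup>2) \<le> (s ^ m)\<^sup>2" for n by simp
    hence "h2_norm g \<le> s ^ m"
      using g s by (intro H2_bounded_sums(2)) (auto simp: H2_def)
    thus "ereal (h2_norm (\<lambda>z. ?T f z - R f z)) \<le> ereal (s ^ m)" by (simp add: g_def)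
  qed
  finally show ?thesis .
qed

lemma approx_num_ext_dilation_ge:
  assumes s: "0 \<le> s" "s \<le> 1"
  shows "ereal (s ^ m) \<le> approx_num_ext (comp_op (\<lambda>z. of_real s * z)) (Suc m)"
  unfolding approx_num_ext_def
proof (intro INF_greatest, clarify)
  let ?T = "comp_op (\<lambda>z. of_real s * z)"
  fix R assume R: "h2_linear_op R" "rank_less R (Suc m)"
  have T: "h2_linear_op ?T" by (intro h2_linear_op_comp_op disk_self_map_dilation s)
  obtain x where x: "\<exists>k\<in>{..<Suc m}. x k \<noteq> 0" "R (\<lambda>z. \<Sum>k<Suc m. x k * disk_monomial k z) = (\<lambda>z. 0)"
    using rank_less_nontrivial_kernel[OF R(1), of "{..<Suc m}" disk_monomial] R(2) disk_monomial_H2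
    by auto
  define P where "P = (\<lambda>z. \<Sum>k<Suc m. x k * disk_monomial k z)"
  have P: "P \<in> H2" unfolding P_def by (rule disk_polynomial_H2)
  have coeff: "taylor_coeff P k = (if k < Suc m then x k else 0)" for k
    unfolding P_def by (rule taylor_coeff_disk_polynomial)
  have norm_P: "(h2_norm P)\<^sup>2 = (\<Sum>k<Suc m. (cmod (x k))\<^sup>2)"
    unfolding h2_norm_power2[OF P] by (subst suminf_finite[of "{..<Suc m}"]) (auto simp: coeff)
  also have "\<dots> > 0"
  proof -
    obtain k where "k \<in> {..<Suc m}" "x k \<noteq> 0" using x(1) by blast
    thus ?thesis by (intro sum_pos2[of _ k]) auto
  qed
  finally have P0: "0 < h2_norm P" using h2_norm_nonneg[OF P] by (simp add: less_le)
  have "(s ^ m * h2_norm P)\<^sup>2 = (\<Sum>k<Suc m. (s ^ m)\<^sup>2 * (cmod (x k))\<^sup>2)"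
    unfolding power_mult_distrib norm_P sum_distrib_left ..
  also have "\<dots> \<le> (\<Sum>k<Suc m. (cmod (taylor_coeff (?T P) k))\<^sup>2)"
    using s P by (intro sum_mono)
      (auto simp: taylor_coeff_comp_op_dilation coeff norm_mult norm_power power_mult_distrib
         intro!: mult_right_mono power_mono power_decreasing)
  also have "\<dots> \<le> (h2_norm (?T P))\<^sup>2" by (intro sum_taylor_coeff_le_h2_norm h2_linear_op_H2[OF T P])
  finally have "s ^ m * h2_norm P \<le> h2_norm (?T P)"
    by (rule power2_le_imp_le) (intro h2_norm_nonneg h2_linear_op_H2[OF T P])
  also have "?T P = (\<lambda>z. ?T P z - R P z)" using x(2) by (simp add: P_def)
  finally have "ereal (h2_norm P) * ereal (s ^ m) \<le> ereal (h2_norm (\<lambda>z. ?T P z - R P z))"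
    by (simp add: mult.commute)
  also have "\<dots> \<le> ereal (h2_norm P) * h2_opnorm (\<lambda>f z. ?T f z - R f z)"
    by (intro h2_norm_le_h2_opnorm[OF h2_linear_op_diff[OF T R(1)] P _ P0] order_refl)
  finally show "ereal (s ^ m) \<le> h2_opnorm (\<lambda>f z. ?T f z - R f z)"
    using P0 by (subst (asm) ereal_mult_le_mult_iff) auto
qed

corollary approx_num_dilation:
  assumes "0 \<le> s" "s \<le> 1"
  shows "approx_num (comp_op (\<lambda>z. of_real s * z)) (Suc m) = s ^ m"
proof -
  have "approx_num_ext (comp_op (\<lambda>z. of_real s * z)) (Suc m) = ereal (s ^ m)"
    using assms by (intro antisym approx_num_ext_dilation_le approx_num_ext_dilation_ge)
  thus ?thesis by (simp add: approx_num_def)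
qed

section \<open>Green energy and its conformal invariance\<close>

abbreviation disk_moebius :: "complex \<Rightarrow> complex \<Rightarrow> complex" where
  "disk_moebius \<equiv> Moebius_function 0"

lemma disk_self_map_moebius: "cmod p < 1 \<Longrightarrow> disk_self_map (disk_moebius p)"
  by (intro disk_self_mapI Moebius_function_holomorphic Moebius_function_norm_lt_1)

lemma disk_moebius_inverse:
  assumes "cmod p < 1" "cmod z < 1"
  shows "disk_moebius p (disk_moebius (- p) z) = z" "disk_moebius (- p) (disk_moebius p z) = z"
  using assms by (auto intro!: Moebius_function_compose)

lemma one_minus_cnj_mult_nonzero:
  assumes "cmod w \<le> 1" "cmod z < 1"
  shows "1 - cnj w * z \<noteq> 0"
proof
  assume "1 - cnj w * z = 0"
  hence "cmod (cnj w * z) = 1" by simp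
  hence "cmod w * cmod z = 1" by (simp add: norm_mult)
  moreover have "cmod w * cmod z \<le> cmod z" using assms by (simp add: mult_left_le_one_le)
  ultimately show False using assms by simp
qed

lemma norm_one_minus_cnj_mult_identity:
  "(cmod (1 - cnj w * z))\<^sup>2 - (cmod (z - w))\<^sup>2 = (1 - (cmod z)\<^sup>2) * (1 - (cmod w)\<^sup>2)"
  unfolding cmod_power2 by (simp add: power2_eq_square algebra_simps)

lemma norm_diff_le_norm_one_minus_cnj_mult:
  assumes "cmod z \<le> 1" "cmod w \<le> 1"
  shows "cmod (z - w) \<le> cmod (1 - cnj w * z)"
proof -
  have "0 \<le> (1 - (cmod z)\<^sup>2) * (1 - (cmod w)\<^sup>2)" using assms by (simp add: power_le_one)
  hence "(cmod (z - w))\<^sup>2 \<le> (cmod (1 - cnj w * z))\<^sup>2"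
    unfolding norm_one_minus_cnj_mult_identity[symmetric] by linarith
  thus ?thesis by (rule power2_le_imp_le) simp
qed

lemma green_moebius:
  assumes "cmod p < 1" "cmod z < 1" "cmod w < 1"
  shows "green (disk_moebius p z) (disk_moebius p w) = green z w"
proof -
  define A B D where "A = 1 - cnj p * z" and "B = 1 - cnj p * w" and "D = 1 - cnj p * p"
  have nz: "A \<noteq> 0" "B \<noteq> 0" "D \<noteq> 0"
    using assms one_minus_cnj_mult_nonzero[of p] by (auto simp: A_def B_def D_def)
  have cnj_B: "cnj B = 1 - p * cnj w" by (simp add: B_def)
  hence cnj_B_nz: "1 - p * cnj w \<noteq> 0" using nz(2) by (metis complex_cnj_zero_iff)
  have diff: "disk_moebius p z - disk_moebius p w = (z - w) * D / (A * B)"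
    using nz unfolding Moebius_function_simple A_def B_def D_def
    by (simp add: divide_simps) (simp add: algebra_simps)
  have one_minus: "1 - cnj (disk_moebius p w) * disk_moebius p z = (1 - cnj w * z) * D / (A * cnj B)"
    using nz cnj_B_nz unfolding Moebius_function_simple cnj_B A_def D_def
    by (simp add: divide_simps) (simp add: algebra_simps)
  have "disk_moebius p z = disk_moebius p w \<longleftrightarrow> z = w"
    using diff nz by (metis divide_eq_0_iff mult_eq_0_iff right_minus_eq)
  moreover have "cmod ((1 - cnj (disk_moebius p w) * disk_moebius p z)
      / (disk_moebius p z - disk_moebius p w))
      = cmod ((1 - cnj w * z) / (z - w))"
    unfolding diff one_minus using nz by (simp add: norm_divide norm_mult)
  ultimately show ?thesis by (simp add: green_def)
qed

lemma borel_measurable_cnj [measurable]: "cnj \<in> borel_measurable borel"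
  by (intro borel_measurable_continuous_onI continuous_intros)

lemma borel_measurable_moebius [measurable]: "disk_moebius p \<in> borel_measurable borel"
  unfolding Moebius_function_simple[abs_def] by measurable

lemma borel_measurable_green [measurable (raw)]:
  assumes [measurable]: "f \<in> borel_measurable M" "g \<in> borel_measurable M"
  shows "(\<lambda>x. green (f x) (g x)) \<in> borel_measurable M"
  unfolding green_def by measurable

lemma admissible_measuresI:
  assumes "prob_space \<mu>" "sets \<mu> = sets borel" "compact L" "L \<subseteq> E \<inter> unit_disk" "AE z in \<mu>. z \<in> L"
  shows "\<mu> \<in> admissible_measures E"
proof -
  have "UNIV - L \<in> sets \<mu>" using assms by (auto intro: borel_closed compact_imp_closed)
  hence "emeasure \<mu> (UNIV - L) = 0"
    using AE_iff_measurable[of "UNIV - L" \<mu> "\<lambda>z. z \<in> L"] assms(5) sets_eq_imp_space_eq[OF assms(2)]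
    by auto
  thus ?thesis using assms by (auto simp: admissible_measures_def)
qed

lemma admissible_measuresE:
  assumes "\<mu> \<in> admissible_measures E"
  obtains L where "compact L" "L \<subseteq> E \<inter> unit_disk" "AE z in \<mu>. z \<in> L"
proof -
  obtain L where L: "compact L" "L \<subseteq> E \<inter> unit_disk" "emeasure \<mu> (UNIV - L) = 0" "sets \<mu> = sets borel"
    using assms by (auto simp: admissible_measures_def)
  hence "AE z in \<mu>. z \<in> L"
    by (intro AE_I[of _ _ "UNIV - L"]) (auto intro: borel_closed compact_imp_closed)
  thus thesis using L that by blast
qed

lemma green_V_antimono:
  assumes "E \<inter> unit_disk \<subseteq> F"
  shows "green_V F \<le> green_V E"
  unfolding green_V_def
proof (rule INF_superset_mono)
  show "admissible_measures E \<subseteq> admissible_measures F"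
  proof
    fix \<mu> assume \<mu>: "\<mu> \<in> admissible_measures E"
    obtain L where L: "compact L" "L \<subseteq> E \<inter> unit_disk" "AE z in \<mu>. z \<in> L"
      using admissible_measuresE[OF \<mu>] .
    have "L \<subseteq> F \<inter> unit_disk" using L(2) assms by blast
    thus "\<mu> \<in> admissible_measures F"
      using \<mu> by (intro admissible_measuresI[OF _ _ L(1) _ L(3)]) (auto simp: admissible_measures_def)
  qed
qed simp

lemma admissible_measures_distr_moebius:
  assumes p: "cmod p < 1" and \<mu>: "\<mu> \<in> admissible_measures E"
  shows "distr \<mu> borel (disk_moebius p) \<in> admissible_measures (disk_moebius p ` (E \<inter> unit_disk))"
proof -
  obtain L where L: "compact L" "L \<subseteq> E \<inter> unit_disk" and AE_L: "AE z in \<mu>. z \<in> L"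
    using admissible_measuresE[OF \<mu>] .
  have [measurable_cong]: "sets \<mu> = sets borel" and "prob_space \<mu>"
    using \<mu> by (auto simp: admissible_measures_def)
  interpret prob_space \<mu> by fact
  have meas: "disk_moebius p \<in> \<mu> \<rightarrow>\<^sub>M borel" by measurable
  show ?thesis
  proof (rule admissible_measuresI)
    show compact_image: "compact (disk_moebius p ` L)"
      using L(2) by (intro compact_continuous_image[OF _ L(1)] holomorphic_on_imp_continuous_on
          holomorphic_on_subset[OF Moebius_function_holomorphic[OF p]]) auto
    show "AE z in distr \<mu> borel (disk_moebius p). z \<in> disk_moebius p ` L"
      using AE_L compact_image
      by (subst AE_distr_iff[OF meas]) (auto intro: borel_closed compact_imp_closed)
    show "disk_moebius p ` L \<subseteq> disk_moebius p ` (E \<inter> unit_disk) \<inter> unit_disk"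
      using L(2) disk_self_map_norm_less_one[OF disk_self_map_moebius[OF p]] by auto
  qed (simp_all add: prob_space_distr[OF meas])
qed

lemma green_energy_distr_moebius:
  assumes p: "cmod p < 1" and \<mu>: "\<mu> \<in> admissible_measures E"
  shows "green_energy (distr \<mu> borel (disk_moebius p)) = green_energy \<mu>"
proof -
  obtain L where L: "L \<subseteq> E \<inter> unit_disk" and AE_L: "AE z in \<mu>. z \<in> L"
    using admissible_measuresE[OF \<mu>] .
  have [measurable_cong]: "sets \<mu> = sets borel" and "prob_space \<mu>"
    using \<mu> by (auto simp: admissible_measures_def)
  interpret prob_space \<mu> by fact
  have meas: "disk_moebius p \<in> \<mu> \<rightarrow>\<^sub>M borel" by measurable
  interpret image: prob_space "distr \<mu> borel (disk_moebius p)" by (rule prob_space_distr[OF meas])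
  have invariant: "green (disk_moebius p z) (disk_moebius p w) = green z w" if "z \<in> L" "w \<in> L" for z w
    using that L by (intro green_moebius p) auto
  have "green_energy (distr \<mu> borel (disk_moebius p))
      = (\<integral>\<^sup>+z. \<integral>\<^sup>+w. green (disk_moebius p z) (disk_moebius p w) \<partial>\<mu> \<partial>\<mu>)"
    unfolding green_energy_def by (simp add: nn_integral_distr)
  also have "\<dots> = (\<integral>\<^sup>+z. \<integral>\<^sup>+w. green z w \<partial>\<mu> \<partial>\<mu>)"
    using AE_L
  proof (intro nn_integral_cong_AE, eventually_elim)
    case (elim z)
    show ?case by (intro nn_integral_cong_AE eventually_mono[OF AE_L] invariant elim)
  qed
  finally show ?thesis by (simp add: green_energy_def)
qed

proposition green_V_moebius_image_le:
  assumes p: "cmod p < 1"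
  shows "green_V (disk_moebius p ` (E \<inter> unit_disk)) \<le> green_V E"
  unfolding green_V_def[of E]
proof (rule INF_greatest)
  fix \<mu> assume \<mu>: "\<mu> \<in> admissible_measures E"
  have "green_V (disk_moebius p ` (E \<inter> unit_disk)) \<le> green_energy (distr \<mu> borel (disk_moebius p))"
    unfolding green_V_def by (intro INF_lower admissible_measures_distr_moebius p \<mu>)
  thus "green_V (disk_moebius p ` (E \<inter> unit_disk)) \<le> green_energy \<mu>"
    by (simp add: green_energy_distr_moebius[OF p \<mu>])
qed

subsection \<open>Lower bound for disks about the origin\<close>

lemma ln_quotient_power_series:
  fixes x :: complex and \<sigma> :: real
  assumes x: "cmod x < 1" and \<sigma>: "0 \<le> \<sigma>" "\<sigma> \<le> 1"
  shows "(\<lambda>n. of_real ((1 - \<sigma> ^ n) / n) * x ^ n) sums (ln (1 - of_real \<sigma> * x) - ln (1 - x))"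
proof -
  have "cmod (of_real \<sigma> * x) < 1"
    using mult_left_le_one_le[of "cmod x" \<sigma>] \<sigma> x by (simp add: norm_mult)
  hence "(\<lambda>n. - ((- (- (of_real \<sigma> * x))) ^ n) / of_nat n - - ((- (- x)) ^ n) / of_nat n) sums
     (ln (1 + - (of_real \<sigma> * x)) - ln (1 + - x))"
    using x by (intro sums_diff Ln_series') auto
  moreover have "(\<lambda>n. - ((- (- (of_real \<sigma> * x))) ^ n) / of_nat n - - ((- (- x)) ^ n) / of_nat n)
      = (\<lambda>n. of_real ((1 - \<sigma> ^ n) / n) * x ^ n)"
    by (auto simp: fun_eq_iff diff_divide_distrib power_mult_distrib algebra_simps)
  ultimately show ?thesis by simp
qed

lemma ln_norm_quotient_ge_partial_sum:
  fixes x :: complex and \<sigma> q :: real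
  assumes x: "cmod x \<le> q" "q < 1" and \<sigma>: "0 \<le> \<sigma>" "\<sigma> \<le> 1"
  shows "Re (\<Sum>n<m. of_real ((1 - \<sigma> ^ n) / n) * x ^ n) - q ^ m / (1 - q)
           \<le> ln (cmod ((1 - of_real \<sigma> * x) / (1 - x)))"
proof -
  define t where "t = (\<lambda>n. of_real ((1 - \<sigma> ^ n) / n) * x ^ n)"
  have q: "0 \<le> q" using x(1) norm_ge_zero[of x] by linarith
  have t_sums: "t sums (ln (1 - of_real \<sigma> * x) - ln (1 - x))"
    unfolding t_def using x by (intro ln_quotient_power_series \<sigma>) simp
  have "cmod (of_real \<sigma>) * cmod x < 1"
    using mult_left_le_one_le[of "cmod x" \<sigma>] \<sigma> x by simp
  hence nz: "1 - of_real \<sigma> * x \<noteq> 0" "1 - x \<noteq> 0"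
    using x by (auto simp: norm_mult dest: arg_cong[of _ _ cmod])
  have t_le: "cmod (t n) \<le> q ^ n" for n
  proof -
    have "\<sigma> ^ n \<le> 1" "0 \<le> \<sigma> ^ n" using \<sigma> by (auto simp: power_le_one)
    hence "\<bar>(1 - \<sigma> ^ n) / real n\<bar> \<le> 1" by (cases n) (auto simp: field_simps)
    hence "cmod (t n) \<le> 1 * q ^ n"
      unfolding t_def norm_mult norm_of_real norm_power using x by (intro mult_mono power_mono) auto
    thus ?thesis by simp
  qed
  have geometric: "(\<lambda>n. q ^ m * q ^ n) sums (q ^ m * (1 / (1 - q)))"
    using q x by (intro sums_mult geometric_sums) auto
  have "cmod (\<Sum>n. t (n + m)) \<le> (\<Sum>n. q ^ m * q ^ n)"
    using t_le[of "_ + m"] geometric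
    by (intro norm_suminf_le) (auto simp: power_add mult.commute sums_iff)
  hence "- (q ^ m / (1 - q)) \<le> Re (\<Sum>n. t (n + m))"
    using geometric abs_Re_le_cmod[of "\<Sum>n. t (n + m)"] by (simp add: sums_iff)
  moreover have "ln (cmod ((1 - of_real \<sigma> * x) / (1 - x))) = Re (suminf t)"
    using nz t_sums by (simp add: norm_divide ln_div sums_iff)
  moreover have "suminf t = (\<Sum>n. t (n + m)) + (\<Sum>n<m. t n)"
    using t_sums by (intro suminf_split_initial_segment) (simp add: sums_iff)
  ultimately show ?thesis by (simp add: t_def)
qed

text \<open>The estimate replaces \<open>\<bar>u - v\<bar>\<close> by \<open>\<bar>1 - cnj v * u\<bar>\<close>; the two agree on the unit circle.\<close>

lemma green_scaled_ge:
  assumes \<rho>: "0 < \<rho>" "\<rho> < 1" and u: "cmod u < 1" and v: "cmod v < 1"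
  shows "ennreal (ln (1 / \<rho>) + ln (cmod ((1 - of_real (\<rho>\<^sup>2) * (cnj v * u)) / (1 - cnj v * u))))
           \<le> green (of_real \<rho> * u) (of_real \<rho> * v)"
proof (cases "u = v")
  case True
  thus ?thesis by (simp add: green_def)
next
  case False
  define N where "N = cmod (1 - of_real (\<rho>\<^sup>2) * (cnj v * u))"
  have "cmod (of_real \<rho> * v) < 1" "cmod (of_real \<rho> * u) < 1"
    using disk_self_map_norm_less_one[OF disk_self_map_dilation[of \<rho>]] \<rho> u v by auto
  hence N: "0 < N"
    using one_minus_cnj_mult_nonzero[of "of_real \<rho> * v" "of_real \<rho> * u"]
    by (simp add: N_def power2_eq_square mult_ac)
  have "0 < cmod (1 - cnj v * u)" using one_minus_cnj_mult_nonzero[of v u] u v by simp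
  moreover have "cmod (u - v) \<le> cmod (1 - cnj v * u)"
    using u v by (intro norm_diff_le_norm_one_minus_cnj_mult) auto
  ultimately have "ln (1 / \<rho>) + ln (N / cmod (1 - cnj v * u)) \<le> ln (1 / \<rho>) + ln (N / cmod (u - v))"
    using N False by (intro add_left_mono ln_mono divide_left_mono) auto
  also have "\<dots> = ln (1 / \<rho> * (N / cmod (u - v)))" using N False \<rho> by (subst ln_mult) auto
  also have "1 / \<rho> * (N / cmod (u - v))
      = cmod ((1 - cnj (of_real \<rho> * v) * (of_real \<rho> * u)) / (of_real \<rho> * u - of_real \<rho> * v))"
  proof -
    have "cmod (of_real \<rho> * u - of_real \<rho> * v) = \<rho> * cmod (u - v)"
      using \<rho> by (simp add: norm_mult flip: right_diff_distrib)
    moreover have "cmod (1 - cnj (of_real \<rho> * v) * (of_real \<rho> * u)) = N"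
      by (simp add: N_def power2_eq_square mult_ac)
    ultimately show ?thesis by (simp add: norm_divide)
  qed
  finally show ?thesis
    using False \<rho> by (auto simp: green_def N_def norm_divide intro: ennreal_leI)
qed

lemma (in prob_space) inner_kernel_integral:
  fixes h :: "nat \<Rightarrow> 'a \<Rightarrow> 'b :: {banach, second_countable_topology, real_inner}"
    and c :: "nat \<Rightarrow> real" and A :: real
  assumes h: "\<And>n. n < m \<Longrightarrow> integrable M (h n)" and c: "\<And>n. n < m \<Longrightarrow> 0 \<le> c n"
  defines "k \<equiv> \<lambda>x y. A + (\<Sum>n<m. c n * (h n x \<bullet> h n y))"
  shows "\<And>x. integrable M (k x)"
    and "integrable M (\<lambda>x. \<integral>y. k x y \<partial>M)"
    and "A \<le> (\<integral>x. (\<integral>y. k x y \<partial>M) \<partial>M)"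
proof -
  show "integrable M (k x)" for x
    unfolding k_def by (intro Bochner_Integration.integrable_add Bochner_Integration.integrable_sum
        integrable_mult_right integrable_inner_right) (use h in auto)
  have inner_integral: "(\<lambda>x. \<integral>y. k x y \<partial>M) = (\<lambda>x. A + (\<Sum>n<m. c n * (h n x \<bullet> (\<integral>y. h n y \<partial>M))))"
  proof
    fix x
    have "(\<integral>y. k x y \<partial>M) = A + (\<integral>y. (\<Sum>n<m. c n * (h n x \<bullet> h n y)) \<partial>M)"
      unfolding k_def using h by (subst Bochner_Integration.integral_add) (auto simp: prob_space)
    thus "(\<integral>y. k x y \<partial>M) = A + (\<Sum>n<m. c n * (h n x \<bullet> (\<integral>y. h n y \<partial>M)))"
      using h by (simp add: Bochner_Integration.integral_sum)
  qed
  show "integrable M (\<lambda>x. \<integral>y. k x y \<partial>M)"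
    unfolding inner_integral
    by (intro Bochner_Integration.integrable_add Bochner_Integration.integrable_sum
        integrable_mult_right integrable_inner_left) (use h in auto)
  have "0 \<le> (\<Sum>n<m. c n * ((\<integral>x. h n x \<partial>M) \<bullet> (\<integral>y. h n y \<partial>M)))"
    using c by (intro sum_nonneg mult_nonneg_nonneg) auto
  also have "A + \<dots> = (\<integral>x. (\<integral>y. k x y \<partial>M) \<partial>M)"
    unfolding inner_integral using h
    by (subst Bochner_Integration.integral_add) (auto simp: prob_space Bochner_Integration.integral_sum)
  finally show "A \<le> (\<integral>x. (\<integral>y. k x y \<partial>M) \<partial>M)" by simp
qed

lemma ennreal_integral_le_nn_integral:
  fixes f :: "'a \<Rightarrow> real"
  assumes f: "integrable M f" and le: "AE x in M. ennreal (f x) \<le> g x"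
  shows "ennreal (\<integral>x. f x \<partial>M) \<le> (\<integral>\<^sup>+x. g x \<partial>M)"
proof -
  have "ennreal (\<integral>x. f x \<partial>M) \<le> ennreal (\<integral>x. max 0 (f x) \<partial>M)"
    using f by (intro ennreal_leI integral_mono) auto
  also have "\<dots> = (\<integral>\<^sup>+x. ennreal (max 0 (f x)) \<partial>M)"
    using f by (intro nn_integral_eq_integral[symmetric]) auto
  also have "\<dots> \<le> (\<integral>\<^sup>+x. g x \<partial>M)" using le by (intro nn_integral_mono_AE) auto
  finally show ?thesis .
qed

text \<open>The sum is a positive definite kernel; \<open>q ^ m / (1 - q)\<close> bounds the tail that the truncation omits.\<close>

definition truncated_green_kernel :: "real \<Rightarrow> real \<Rightarrow> nat \<Rightarrow> complex \<Rightarrow> complex \<Rightarrow> real" where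
  "truncated_green_kernel \<rho> q m z w = ln (1 / \<rho>) - q ^ m / (1 - q)
     + (\<Sum>n<m. (1 - (\<rho>\<^sup>2) ^ n) / n * ((z / of_real \<rho>) ^ n \<bullet> (w / of_real \<rho>) ^ n))"

lemma truncated_green_kernel_le_green:
  assumes s: "0 < s" "s < \<rho>" "\<rho> < 1" and z: "cmod z \<le> s" and w: "cmod w \<le> s"
  shows "ennreal (truncated_green_kernel \<rho> ((s / \<rho>)\<^sup>2) m z w) \<le> green z w"
proof -
  define q where "q = (s / \<rho>)\<^sup>2"
  define u v where "u = z / of_real \<rho>" and "v = w / of_real \<rho>"
  have q: "q < 1" unfolding q_def using s by (intro power_less_one_iff[THEN iffD2]) auto
  have uv: "cmod u \<le> s / \<rho>" "cmod v \<le> s / \<rho>"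
    using s z w by (simp_all add: u_def v_def norm_divide divide_right_mono)
  hence "cmod (cnj v * u) \<le> (s / \<rho>) * (s / \<rho>)"
    unfolding norm_mult complex_mod_cnj by (intro mult_mono) (use s in auto)
  hence vu: "cmod (cnj v * u) \<le> q" by (simp add: q_def power2_eq_square)
  have "u ^ n \<bullet> v ^ n = Re ((cnj v * u) ^ n)" for n
  proof -
    have "x \<bullet> y = Re (cnj y * x)" for x y :: complex by (simp add: inner_complex_def)
    thus ?thesis by (simp only: power_mult_distrib complex_cnj_power)
  qed
  hence "truncated_green_kernel \<rho> q m z w
      = ln (1 / \<rho>) + (Re (\<Sum>n<m. of_real ((1 - (\<rho>\<^sup>2) ^ n) / n) * (cnj v * u) ^ n) - q ^ m / (1 - q))"
    by (simp add: truncated_green_kernel_def flip: u_def v_def)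
  also have "\<dots> \<le> ln (1 / \<rho>) + ln (cmod ((1 - of_real (\<rho>\<^sup>2) * (cnj v * u)) / (1 - cnj v * u)))"
    using s by (intro add_left_mono ln_norm_quotient_ge_partial_sum[OF vu q]) (auto simp: power_le_one)
  finally have "ennreal (truncated_green_kernel \<rho> q m z w) \<le> ennreal \<dots>" by (rule ennreal_leI)
  also have "\<dots> \<le> green (of_real \<rho> * u) (of_real \<rho> * v)"
    using uv s by (intro green_scaled_ge) (auto intro: le_less_trans)
  finally show ?thesis using s by (simp add: u_def v_def q_def)
qed

lemma integrable_scaled_power:
  fixes M :: "complex measure"
  assumes "finite_measure M" and sets_M: "sets M = sets borel" and supp: "AE z in M. cmod z \<le> \<rho>"
  shows "integrable M (\<lambda>z. (z / of_real \<rho>) ^ n)"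
proof (rule finite_measure.integrable_const_bound[OF assms(1), of _ 1])
  note [measurable_cong] = sets_M
  show "(\<lambda>z. (z / of_real \<rho>) ^ n) \<in> borel_measurable M" by measurable
  have "cmod ((z / of_real \<rho>) ^ n) \<le> 1" if "cmod z \<le> \<rho>" for z
    unfolding norm_power using that
    by (intro power_le_one) (auto simp: norm_divide divide_le_eq)
  thus "AE z in M. norm ((z / of_real \<rho>) ^ n) \<le> 1" by (rule eventually_mono[OF supp])
qed

lemma green_energy_ge_truncated:
  assumes "prob_space \<mu>" and "sets \<mu> = sets borel"
    and supp: "AE z in \<mu>. cmod z \<le> s" and s: "0 < s" "s < \<rho>" "\<rho> < 1"
  shows "ennreal (ln (1 / \<rho>) - ((s / \<rho>)\<^sup>2) ^ m / (1 - (s / \<rho>)\<^sup>2)) \<le> green_energy \<mu>"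
proof -
  interpret prob_space \<mu> by fact
  define q where "q = (s / \<rho>)\<^sup>2"
  define k where "k = truncated_green_kernel \<rho> q m"
  have k_le: "ennreal (k z w) \<le> green z w" if "cmod z \<le> s" "cmod w \<le> s" for z w
    unfolding k_def q_def using s that by (rule truncated_green_kernel_le_green)
  have powers: "integrable \<mu> (\<lambda>z. (z / of_real \<rho>) ^ n)" for n
    using supp s
    by (intro integrable_scaled_power finite_measure_axioms assms) (auto elim!: eventually_mono)
  have weights: "0 \<le> (1 - (\<rho>\<^sup>2) ^ n) / n" for n using s by (auto simp: power_le_one)
  have "ln (1 / \<rho>) - q ^ m / (1 - q) \<le> (\<integral>z. (\<integral>w. k z w \<partial>\<mu>) \<partial>\<mu>)"
    and integrable_potential: "integrable \<mu> (\<lambda>z. \<integral>w. k z w \<partial>\<mu>)"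
    and integrable_kernel: "integrable \<mu> (k z)" for z
    unfolding k_def truncated_green_kernel_def[abs_def]
    by (rule inner_kernel_integral[OF powers weights])+
  hence "ennreal (ln (1 / \<rho>) - q ^ m / (1 - q)) \<le> ennreal (\<integral>z. (\<integral>w. k z w \<partial>\<mu>) \<partial>\<mu>)"
    by (intro ennreal_leI)
  also have "\<dots> \<le> (\<integral>\<^sup>+z. (\<integral>\<^sup>+w. green z w \<partial>\<mu>) \<partial>\<mu>)"
  proof (rule ennreal_integral_le_nn_integral[OF integrable_potential])
    show "AE z in \<mu>. ennreal (\<integral>w. k z w \<partial>\<mu>) \<le> (\<integral>\<^sup>+w. green z w \<partial>\<mu>)"
      using supp
    proof eventually_elim
      case (elim z)
      show ?case
        by (rule ennreal_integral_le_nn_integral[OF integrable_kernel])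
           (intro eventually_mono[OF supp] k_le elim)
    qed
  qed
  finally show ?thesis by (simp add: green_energy_def q_def)
qed

lemma green_energy_ge:
  assumes \<mu>: "prob_space \<mu>" "sets \<mu> = sets borel" "AE z in \<mu>. cmod z \<le> s" and s: "0 < s" "s < 1"
  shows "ennreal (ln (1 / s)) \<le> green_energy \<mu>"
proof (rule tendsto_upperbound)
  show "((\<lambda>\<rho>. ennreal (ln (1 / \<rho>))) \<longlongrightarrow> ennreal (ln (1 / s))) (at_right s)"
    using s by (intro tendsto_ennrealI tendsto_intros) auto
  have "ennreal (ln (1 / \<rho>)) \<le> green_energy \<mu>" if \<rho>: "s < \<rho>" "\<rho> < 1" for \<rho>
  proof (rule tendsto_upperbound)
    define q where "q = (s / \<rho>)\<^sup>2"
    have q: "q < 1" "0 \<le> q" unfolding q_def using s \<rho> by (auto simp: power_less_one_iff)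
    hence "(\<lambda>m. ln (1 / \<rho>) - q ^ m / (1 - q)) \<longlonglongrightarrow> ln (1 / \<rho>) - 0 / (1 - q)"
      by (intro tendsto_intros LIMSEQ_power_zero) auto
    thus "(\<lambda>m. ennreal (ln (1 / \<rho>) - q ^ m / (1 - q))) \<longlonglongrightarrow> ennreal (ln (1 / \<rho>))"
      by (intro tendsto_ennrealI) simp
    show "\<forall>\<^sub>F m in sequentially. ennreal (ln (1 / \<rho>) - q ^ m / (1 - q)) \<le> green_energy \<mu>"
      unfolding q_def using green_energy_ge_truncated[OF \<mu> s(1) \<rho>] by simp
  qed simp
  thus "\<forall>\<^sub>F \<rho> in at_right s. ennreal (ln (1 / \<rho>)) \<le> green_energy \<mu>"
    using s by (intro eventually_at_rightI[of s 1]) auto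
qed simp

corollary green_V_cball_ge:
  assumes s: "0 < s" "s < 1"
  shows "ennreal (ln (1 / s)) \<le> green_V (cball 0 s)"
  unfolding green_V_def
proof (rule INF_greatest)
  fix \<mu> assume \<mu>: "\<mu> \<in> admissible_measures (cball 0 s)"
  then obtain L where "L \<subseteq> cball 0 s \<inter> unit_disk" "AE z in \<mu>. z \<in> L" by (rule admissible_measuresE)
  hence "AE z in \<mu>. cmod z \<le> s" by (auto elim!: eventually_mono)
  thus "ennreal (ln (1 / s)) \<le> green_energy \<mu>"
    using \<mu> s by (intro green_energy_ge) (auto simp: admissible_measures_def)
qed

subsection \<open>Upper bound for circles about the origin\<close>

lemma ln_green_nonneg:
  assumes "cmod z < 1" "cmod w < 1" "z \<noteq> w"
  shows "0 \<le> ln (cmod ((1 - cnj w * z) / (z - w)))"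
  using norm_diff_le_norm_one_minus_cnj_mult[of z w] assms
  by (intro ln_ge_zero) (simp add: norm_divide)

lemma green_commute: "green z w = green w z"
proof -
  have "cmod (1 - cnj w * z) = cmod (1 - cnj z * w)"
    by (metis complex_cnj_cnj complex_cnj_diff complex_cnj_mult
        complex_cnj_one complex_mod_cnj mult.commute)
  thus ?thesis by (simp add: green_def norm_divide norm_minus_commute)
qed

lemma green_tendsto:
  assumes w: "cmod w < 1" and z: "cmod z < 1"
  shows "((\<lambda>y. green y w) \<longlongrightarrow> green z w) (at z)"
proof (rule Lim_transform_eventually)
  show "\<forall>\<^sub>F y in at z. ennreal (ln (cmod ((1 - cnj w * y) / (y - w)))) = green y w"
    using eventually_neq_at_within[of w z UNIV] by eventually_elim (simp add: green_def)
  show "((\<lambda>y. ennreal (ln (cmod ((1 - cnj w * y) / (y - w))))) \<longlongrightarrow> green z w) (at z)"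
  proof (cases "z = w")
    case False
    hence "((\<lambda>y. ennreal (ln (cmod ((1 - cnj w * y) / (y - w)))))
        \<longlongrightarrow> ennreal (ln (cmod ((1 - cnj w * z) / (z - w))))) (at z)"
      using one_minus_cnj_mult_nonzero[of w z] w z by (intro tendsto_ennrealI tendsto_intros) auto
    thus ?thesis using False by (simp add: green_def)
  next
    case True
    have numerator: "((\<lambda>y. cmod (1 - cnj w * y)) \<longlongrightarrow> cmod (1 - cnj w * w)) (at w)"
      by (intro tendsto_intros)
    have "((\<lambda>y. cmod (y - w)) \<longlongrightarrow> cmod (w - w)) (at w)" by (intro tendsto_intros)
    hence "filterlim (\<lambda>y. cmod (y - w)) (at_right 0) (at w)"
      by (auto simp: filterlim_at eventually_at_filter)
    hence "filterlim (\<lambda>y. inverse (cmod (y - w))) at_top (at w)"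
      by (rule filterlim_compose[OF filterlim_inverse_at_top_right])
    hence "filterlim (\<lambda>y. cmod (1 - cnj w * y) * inverse (cmod (y - w))) at_top (at w)"
      using one_minus_cnj_mult_nonzero[of w w] w
      by (intro filterlim_tendsto_pos_mult_at_top[OF numerator]) auto
    hence "filterlim (\<lambda>y. ln (cmod ((1 - cnj w * y) / (y - w)))) at_top (at w)"
      unfolding norm_divide divide_inverse[symmetric] by (rule filterlim_compose[OF ln_at_top])
    thus ?thesis using True by (simp add: green_def ennreal_tendsto_top_eq_at_top)
  qed
qed

definition circle_measure :: "real \<Rightarrow> complex measure" where
  "circle_measure r = distr (restrict_space lborel {0..1}) borel (circlepath 0 r)"

lemma measurable_circlepath_unit_interval [measurable]:
  "circlepath 0 r \<in> restrict_space lborel {0..1} \<rightarrow>\<^sub>M borel"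
  by (intro measurable_restrict_space1)
      (simp add: borel_measurable_continuous_onI continuous_on_circlepath)

lemma sets_circle_measure [simp, measurable_cong]: "sets (circle_measure r) = sets borel"
  by (simp add: circle_measure_def)

lemma prob_space_circle_measure: "prob_space (circle_measure r)"
  unfolding circle_measure_def
  by (intro prob_space.prob_space_distr prob_space_restrict_space) auto

lemma AE_circle_measure:
  assumes "0 < r"
  shows "AE z in circle_measure r. z \<in> sphere 0 r"
  unfolding circle_measure_def using assms by (subst AE_distr_iff) auto

lemma nn_integral_circle_measure:
  assumes "f \<in> borel_measurable borel"
  shows "(\<integral>\<^sup>+z. f z \<partial>circle_measure r) = (\<integral>\<^sup>+t. f (circlepath 0 r t) * indicator {0..1} t \<partial>lborel)"
  using assms by (simp add: circle_measure_def nn_integral_distr nn_integral_restrict_space)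

lemma green_potential_circle_outside:
  assumes s: "0 < s" "s < cmod z" and z: "cmod z < 1"
  shows "(\<integral>\<^sup>+w. green z w \<partial>circle_measure s) = ennreal (ln (1 / cmod z))"
proof -
  define h where "h = (\<lambda>w. (1 - cnj z * w) / (w - z))"
  have nz: "1 - cnj z * w \<noteq> 0" "w - z \<noteq> 0" if "w \<in> ball 0 (cmod z)" for w
    using that z one_minus_cnj_mult_nonzero[of z w] by auto
  have "((\<lambda>t. ln (cmod (h (circlepath 0 s t)))) has_integral ln (cmod (h 0))) {0..1}"
  proof (rule circlepath_mean_value_ln_norm[OF _ _ s])
    show "h holomorphic_on ball 0 (cmod z)"
      unfolding h_def using nz by (intro holomorphic_intros) auto
    show "h w \<noteq> 0" if "w \<in> ball 0 (cmod z)" for w using nz[OF that] by (simp add: h_def)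
  qed
  moreover have "0 \<le> ln (cmod (h (circlepath 0 s t)))" for t
    unfolding h_def using s z by (intro ln_green_nonneg) auto
  ultimately have "(\<integral>\<^sup>+t. ennreal (ln (cmod (h (circlepath 0 s t)))) * indicator {0..1} t \<partial>lborel)
      = ennreal (ln (cmod (h 0)))"
    by (intro nn_integral_has_integral_lebesgue')
  moreover have "green z (circlepath 0 s t) = ennreal (ln (cmod (h (circlepath 0 s t))))" for t
    unfolding green_commute[of z] using s by (auto simp: green_def h_def)
  moreover have "cmod (h 0) = 1 / cmod z" by (simp add: h_def norm_divide)
  ultimately show ?thesis by (simp add: nn_integral_circle_measure)
qed

text \<open>Fatou's lemma bounds the potential on the circle by its values at points approaching the circle
  from outside.\<close>

lemma green_potential_circle_le:
  assumes s: "0 < s" "s < 1" and z: "cmod z = s"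
  shows "(\<integral>\<^sup>+w. green z w \<partial>circle_measure s) \<le> ennreal (ln (1 / s))"
proof -
  obtain u where u: "\<And>n. s < u n" "u \<longlonglongrightarrow> s"
    using approx_from_above_dense_linorder[OF s(2)] by blast
  define y where "y = (\<lambda>n. of_real (u n / s) * z)"
  have norm_y: "cmod (y n) = u n" for n
    unfolding y_def norm_mult norm_of_real z using s u(1)[of n] by simp
  have "y \<longlonglongrightarrow> of_real (s / s) * z" unfolding y_def using s by (intro tendsto_intros u) auto
  hence y_lim: "filterlim y (at z) sequentially"
    using s z u(1) norm_y by (force simp: filterlim_at intro!: always_eventually)
  have outside: "(\<lambda>n. \<integral>\<^sup>+w. green (y n) w \<partial>circle_measure s) \<longlonglongrightarrow> ennreal (ln (1 / s))"
  proof (rule Lim_transform_eventually)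
    show "(\<lambda>n. ennreal (ln (1 / u n))) \<longlonglongrightarrow> ennreal (ln (1 / s))"
      using s by (intro tendsto_ennrealI tendsto_intros u) auto
    show "\<forall>\<^sub>F n in sequentially. ennreal (ln (1 / u n)) = (\<integral>\<^sup>+w. green (y n) w \<partial>circle_measure s)"
      using order_tendstoD(2)[OF u(2) s(2)]
      by eventually_elim (simp add: green_potential_circle_outside norm_y s u(1))
  qed
  have "(\<integral>\<^sup>+w. green z w \<partial>circle_measure s) = (\<integral>\<^sup>+w. liminf (\<lambda>n. green (y n) w) \<partial>circle_measure s)"
    using AE_circle_measure[OF s(1)]
  proof (intro nn_integral_cong_AE, eventually_elim)
    case (elim w)
    hence "(\<lambda>n. green (y n) w) \<longlonglongrightarrow> green z w"
      using s z by (intro filterlim_compose[OF green_tendsto y_lim]) auto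
    thus ?case by (intro lim_imp_Liminf[symmetric]) auto
  qed
  also have "\<dots> \<le> liminf (\<lambda>n. \<integral>\<^sup>+w. green (y n) w \<partial>circle_measure s)"
    by (intro nn_integral_liminf) measurable
  also have "\<dots> = ennreal (ln (1 / s))" by (rule lim_imp_Liminf[OF _ outside]) simp
  finally show ?thesis .
qed

lemma green_V_sphere_le:
  assumes s: "0 < s" "s < 1"
  shows "green_V (sphere 0 s) \<le> ennreal (ln (1 / s))"
proof -
  interpret prob_space "circle_measure s" by (rule prob_space_circle_measure)
  have "circle_measure s \<in> admissible_measures (sphere 0 s)"
    by (rule admissible_measuresI[of _ "sphere 0 s"])
       (use s AE_circle_measure[OF s(1)] prob_space_axioms in auto)
  hence "green_V (sphere 0 s) \<le> green_energy (circle_measure s)"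
    unfolding green_V_def by (rule INF_lower)
  also have "\<dots> \<le> (\<integral>\<^sup>+z. ennreal (ln (1 / s)) \<partial>circle_measure s)"
    unfolding green_energy_def
    by (intro nn_integral_mono_AE eventually_mono[OF AE_circle_measure[OF s(1)]]
        green_potential_circle_le[OF s]) simp
  also have "\<dots> = ennreal (ln (1 / s))" by (simp add: emeasure_space_1)
  finally show ?thesis .
qed

section \<open>Pseudohyperbolic disks\<close>

definition pseudo_ball :: "complex \<Rightarrow> real \<Rightarrow> complex set" where
  "pseudo_ball p s = {z \<in> unit_disk. cmod (disk_moebius p z) < s}"

definition pseudo_cball :: "complex \<Rightarrow> real \<Rightarrow> complex set" where
  "pseudo_cball p s = {z \<in> unit_disk. cmod (disk_moebius p z) \<le> s}"

lemma pseudo_cball_subset_pseudo_ball: "s < s' \<Longrightarrow> pseudo_cball p s \<subseteq> pseudo_ball p s'"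
  by (auto simp: pseudo_ball_def pseudo_cball_def)

lemma closure_pseudo_ball_subset:
  assumes "cmod p < 1"
  shows "closure (pseudo_ball p s) \<inter> unit_disk \<subseteq> pseudo_cball p s"
proof -
  have "continuous_on unit_disk (\<lambda>z. cmod (disk_moebius p z))"
    by (intro continuous_intros holomorphic_on_imp_continuous_on Moebius_function_holomorphic assms)
  hence "closedin (top_of_set unit_disk) (unit_disk \<inter> (\<lambda>z. cmod (disk_moebius p z)) -` {..s})"
    by (intro continuous_closedin_preimage) auto
  then obtain T where T: "closed T" "unit_disk \<inter> (\<lambda>z. cmod (disk_moebius p z)) -` {..s} = T \<inter> unit_disk"
    by (auto simp: closedin_closed)
  have "pseudo_ball p s \<subseteq> T \<inter> unit_disk"
    unfolding T(2)[symmetric] by (auto simp: pseudo_ball_def)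
  hence "closure (pseudo_ball p s) \<subseteq> T" by (intro closure_minimal T(1)) blast
  hence "closure (pseudo_ball p s) \<inter> unit_disk \<subseteq> T \<inter> unit_disk" by blast
  also have "\<dots> \<subseteq> pseudo_cball p s" unfolding T(2)[symmetric] by (auto simp: pseudo_cball_def)
  finally show ?thesis .
qed

lemma green_V_pseudo_cball:
  assumes p: "cmod p < 1" and s: "0 < s" "s < 1"
  shows "green_V (pseudo_cball p s) = ennreal (ln (1 / s))"
proof (rule antisym)
  have "disk_moebius (- p) z \<in> pseudo_cball p s" if "z \<in> sphere 0 s \<inter> unit_disk" for z
    using that p disk_self_map_norm_less_one[OF disk_self_map_moebius[of "- p"], of z]
    by (simp add: pseudo_cball_def disk_moebius_inverse)
  hence "green_V (pseudo_cball p s) \<le> green_V (disk_moebius (- p) ` (sphere 0 s \<inter> unit_disk))"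
    by (intro green_V_antimono) auto
  also have "\<dots> \<le> green_V (sphere 0 s)" using p by (intro green_V_moebius_image_le) simp
  also have "\<dots> \<le> ennreal (ln (1 / s))" by (rule green_V_sphere_le[OF s])
  finally show "green_V (pseudo_cball p s) \<le> ennreal (ln (1 / s))" .
next
  have "ennreal (ln (1 / s)) \<le> green_V (cball 0 s)" by (rule green_V_cball_ge[OF s])
  also have "\<dots> \<le> green_V (disk_moebius p ` (pseudo_cball p s \<inter> unit_disk))"
    by (intro green_V_antimono) (auto simp: pseudo_cball_def)
  also have "\<dots> \<le> green_V (pseudo_cball p s)" by (rule green_V_moebius_image_le[OF p])
  finally show "ennreal (ln (1 / s)) \<le> green_V (pseudo_cball p s)" .
qed

lemma green_V_eqI:
  assumes p: "cmod p < 1" and \<beta>: "0 < \<beta>" "\<beta> \<le> 1" and outer: "E \<inter> unit_disk \<subseteq> pseudo_cball p \<beta>"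
    and inner: "\<And>s. 0 < s \<Longrightarrow> s < \<beta> \<Longrightarrow> \<exists>q. cmod q < 1 \<and> pseudo_cball q s \<subseteq> E"
  shows "green_V E = ennreal (ln (1 / \<beta>))"
proof (rule antisym)
  show "ennreal (ln (1 / \<beta>)) \<le> green_V E"
  proof (cases "\<beta> = 1")
    case False
    hence "ennreal (ln (1 / \<beta>)) = green_V (pseudo_cball p \<beta>)"
      using p \<beta> by (simp add: green_V_pseudo_cball)
    also have "\<dots> \<le> green_V E" by (rule green_V_antimono[OF outer])
    finally show ?thesis .
  qed simp
  show "green_V E \<le> ennreal (ln (1 / \<beta>))"
  proof (rule tendsto_lowerbound)
    show "((\<lambda>s. ennreal (ln (1 / s))) \<longlongrightarrow> ennreal (ln (1 / \<beta>))) (at_left \<beta>)"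
      using \<beta> by (intro tendsto_ennrealI tendsto_intros) auto
    have "green_V E \<le> ennreal (ln (1 / s))" if s: "0 < s" "s < \<beta>" for s
    proof -
      obtain q where q: "cmod q < 1" "pseudo_cball q s \<subseteq> E" using inner[OF s] by auto
      hence "green_V E \<le> green_V (pseudo_cball q s)" by (intro green_V_antimono) auto
      thus ?thesis using q s \<beta> by (simp add: green_V_pseudo_cball)
    qed
    thus "\<forall>\<^sub>F s in at_left \<beta>. green_V E \<le> ennreal (ln (1 / s))"
      using \<beta> by (intro eventually_at_leftI[of 0]) auto
  qed simp
qed

lemma exp_neg_inv_green_cap:
  assumes "green_V E = ennreal (ln (1 / s))" "0 < s" "s \<le> 1"
  shows "exp_neg_inv (green_cap E) = s"
proof (cases "s = 1")
  case True
  thus ?thesis using assms by (simp add: green_cap_def exp_neg_inv_def)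
next
  case False
  hence pos: "0 < ln (1 / s)" using assms by simp
  hence "green_cap E = ennreal (1 / ln (1 / s))"
    using assms by (simp add: green_cap_def inverse_ennreal inverse_eq_divide ennreal_eq_0_iff)
  moreover have "exp (- 1 / (1 / ln (1 / s))) = s" using assms by (simp add: ln_div)
  ultimately show ?thesis using pos by (simp add: exp_neg_inv_def ennreal_eq_0_iff)
qed

section \<open>Univalent maps between pseudohyperbolic disks\<close>

lemma approx_num_comp_op_le_if_image_subset:
  assumes \<phi>: "disk_self_map \<phi>" and p: "cmod p < 1" and s: "0 < s" "s \<le> 1"
    and image: "\<phi> ` unit_disk \<subseteq> pseudo_ball p s"
  obtains C where "\<And>m. approx_num (comp_op \<phi>) (Suc m) \<le> C * s ^ m"
proof
  define \<tau> where "\<tau> = (\<lambda>z. disk_moebius p (\<phi> z) / of_real s)"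
  have "\<tau> holomorphic_on unit_disk"
    unfolding \<tau>_def using s
    by (intro holomorphic_intros holomorphic_on_compose_disk_self_map[OF _ \<phi>]
        Moebius_function_holomorphic p) auto
  moreover have "cmod (\<tau> z) < 1" if "cmod z < 1" for z
  proof -
    have "\<phi> z \<in> pseudo_ball p s" using image that by auto
    thus ?thesis using s by (simp add: \<tau>_def pseudo_ball_def norm_divide)
  qed
  ultimately have \<tau>: "disk_self_map \<tau>" by (rule disk_self_mapI)
  have "\<phi> z = disk_moebius (- p) (of_real s * \<tau> z)" if "z \<in> unit_disk" for z
    using that s p disk_self_map_norm_less_one[OF \<phi>] by (simp add: \<tau>_def disk_moebius_inverse)
  hence "comp_op \<phi> = comp_op (\<lambda>z. disk_moebius (- p) (of_real s * \<tau> z))" by (rule comp_op_cong)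
  thus "approx_num (comp_op \<phi>) (Suc m)
      \<le> 1 / ((1 - cmod (\<tau> 0)) * (1 - cmod (disk_moebius (- p) 0))) * s ^ m" for m
    using approx_num_comp_op_compose_le[OF disk_self_map_dilation \<tau> disk_self_map_moebius,
        of s "- p" "Suc m"] s p
    by (simp add: approx_num_dilation)
qed

lemma approx_num_comp_op_ge_if_subset_image:
  assumes \<phi>: "disk_self_map \<phi>" "inj_on \<phi> unit_disk" and p: "cmod p < 1" and s: "0 < s" "s \<le> 1"
    and image: "pseudo_cball p s \<subseteq> \<phi> ` unit_disk"
  obtains c where "0 < c" "\<And>m. c * s ^ m \<le> approx_num (comp_op \<phi>) (Suc m)"
proof -
  obtain g where g: "g holomorphic_on \<phi> ` unit_disk" "\<And>z. z \<in> unit_disk \<Longrightarrow> g (\<phi> z) = z"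
    using holomorphic_has_inverse[OF disk_self_map_holomorphic[OF \<phi>(1)] open_ball \<phi>(2)] by metis
  define h where "h = (\<lambda>z. disk_moebius (- p) (of_real s * z))"
  have h: "disk_self_map h"
    unfolding h_def using disk_self_map_compose[OF disk_self_map_dilation disk_self_map_moebius] s p
    by simp
  have moebius_h: "disk_moebius p (h z) = of_real s * z" if "z \<in> unit_disk" for z
    using that p disk_self_map_norm_less_one[OF disk_self_map_dilation[of s]] s
    by (simp add: h_def disk_moebius_inverse)
  have h_image: "h z \<in> \<phi> ` unit_disk" if "z \<in> unit_disk" for z
  proof -
    have "h z \<in> pseudo_cball p s"
      using that s moebius_h[OF that] disk_self_map_norm_less_one[OF h, of z]
      by (simp add: pseudo_cball_def norm_mult mult_left_le)
    thus ?thesis using image by blast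
  qed
  define \<sigma> where "\<sigma> = (\<lambda>z. g (h z))"
  have \<phi>_\<sigma>: "\<phi> (\<sigma> z) = h z" and \<sigma>_disk: "\<sigma> z \<in> unit_disk" if z: "z \<in> unit_disk" for z
  proof -
    obtain x where "x \<in> unit_disk" "h z = \<phi> x" using h_image[OF z] by auto
    thus "\<phi> (\<sigma> z) = h z" "\<sigma> z \<in> unit_disk" using g(2) by (auto simp: \<sigma>_def)
  qed
  have "\<sigma> holomorphic_on unit_disk"
    unfolding \<sigma>_def using h_image
    by (intro holomorphic_on_compose_gen[OF disk_self_map_holomorphic[OF h] g(1), unfolded o_def]) auto
  hence \<sigma>: "disk_self_map \<sigma>" using \<sigma>_disk by (intro disk_self_mapI) auto
  define C where "C = 1 / ((1 - cmod (\<sigma> 0)) * (1 - cmod (disk_moebius p 0)))"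
  have "0 < C"
    using disk_self_map_norm_less_one[OF \<sigma>, of 0]
        disk_self_map_norm_less_one[OF disk_self_map_moebius[OF p], of 0]
    by (simp add: C_def)
  have "comp_op (\<lambda>z. disk_moebius p (\<phi> (\<sigma> z))) = comp_op (\<lambda>z. of_real s * z)"
    by (rule comp_op_cong) (simp only: \<phi>_\<sigma> moebius_h)
  hence "s ^ m \<le> C * approx_num (comp_op \<phi>) (Suc m)" for m
    using approx_num_comp_op_compose_le[OF \<phi>(1) \<sigma> disk_self_map_moebius[OF p], of "Suc m"] s
    by (simp add: C_def approx_num_dilation)
  thus thesis using that[of "1 / C"] \<open>0 < C\<close> by (simp add: field_simps)
qed

lemma powr_inverse_Suc_tendsto:
  fixes C s :: real
  assumes "0 < C" "0 < s"
  shows "(\<lambda>m. (C * s ^ m) powr (1 / real (Suc m))) \<longlonglongrightarrow> s"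
proof -
  have "(C * s ^ m) powr (1 / real (Suc m)) = (C / s) powr (1 / real (Suc m)) * s" for m
  proof -
    have "C * s ^ m = (C / s) * s powr real (Suc m)"
      using assms by (simp add: powr_realpow del: of_nat_Suc)
    thus ?thesis using assms by (simp only: powr_mult powr_powr) simp
  qed
  moreover have "(\<lambda>m. (C / s) powr (1 / real (Suc m)) * s) \<longlonglongrightarrow> (C / s) powr 0 * s"
    using assms by (intro tendsto_intros LIMSEQ_Suc[OF lim_1_over_n]) auto
  ultimately show ?thesis using assms by simp
qed

lemma powr_inverse_tendsto_growth_rate:
  fixes a :: "nat \<Rightarrow> real"
  assumes \<beta>: "0 < \<beta>" and upper: "\<And>m. a (Suc m) \<le> C * \<beta> ^ m"
    and lower: "\<And>s. 0 < s \<Longrightarrow> s < \<beta> \<Longrightarrow> \<exists>c>0. \<forall>m. c * s ^ m \<le> a (Suc m)"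
  shows "(\<lambda>n. a n powr (1 / real n)) \<longlonglongrightarrow> \<beta>"
proof -
  have pos: "0 < a (Suc m)" for m
  proof -
    obtain c where "c > 0" "c * (\<beta> / 2) ^ m \<le> a (Suc m)" using lower[of "\<beta> / 2"] \<beta> by auto
    moreover have "0 < c * (\<beta> / 2) ^ m" using \<open>c > 0\<close> \<beta> by simp
    ultimately show ?thesis by linarith
  qed
  have "(\<lambda>m. a (Suc m) powr (1 / real (Suc m))) \<longlonglongrightarrow> \<beta>"
  proof (rule order_tendstoI)
    fix y assume "y < \<beta>"
    obtain s where s: "0 < s" "y < s" "s < \<beta>" using dense[of "max 0 y" \<beta>] \<open>y < \<beta>\<close> \<beta> by auto
    obtain c where c: "c > 0" "\<And>m. c * s ^ m \<le> a (Suc m)" using lower[OF s(1,3)] by auto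
    have "\<forall>\<^sub>F m in sequentially. y < (c * s ^ m) powr (1 / real (Suc m))"
      by (rule order_tendstoD(1)[OF powr_inverse_Suc_tendsto[OF c(1) s(1)] s(2)])
    thus "\<forall>\<^sub>F m in sequentially. y < a (Suc m) powr (1 / real (Suc m))"
    proof eventually_elim
      case (elim m)
      have "(c * s ^ m) powr (1 / real (Suc m)) \<le> a (Suc m) powr (1 / real (Suc m))"
        using c s by (intro powr_mono2) auto
      with elim show ?case by linarith
    qed
  next
    fix y assume y: "\<beta> < y"
    have "0 < C" using pos[of 0] upper[of 0] by simp
    have "\<forall>\<^sub>F m in sequentially. (C * \<beta> ^ m) powr (1 / real (Suc m)) < y"
      by (rule order_tendstoD(2)[OF powr_inverse_Suc_tendsto[OF \<open>0 < C\<close> \<beta>] y])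
    thus "\<forall>\<^sub>F m in sequentially. a (Suc m) powr (1 / real (Suc m)) < y"
    proof eventually_elim
      case (elim m)
      have "a (Suc m) powr (1 / real (Suc m)) \<le> (C * \<beta> ^ m) powr (1 / real (Suc m))"
        using pos[of m] upper[of m] by (intro powr_mono2) auto
      with elim show ?case by linarith
    qed
  qed
  thus ?thesis by (subst (asm) filterlim_sequentially_Suc)
qed

proposition approx_num_limit_eq_green_cap:
  assumes \<phi>: "disk_self_map \<phi>" "inj_on \<phi> unit_disk" and p: "cmod p < 1" and \<beta>: "0 < \<beta>" "\<beta> \<le> 1"
    and outer: "\<phi> ` unit_disk \<subseteq> pseudo_ball p \<beta>"
    and inner: "\<And>s. 0 < s \<Longrightarrow> s < \<beta> \<Longrightarrow> \<exists>q. cmod q < 1 \<and> pseudo_cball q s \<subseteq> \<phi> ` unit_disk"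
  shows "(\<lambda>n. approx_num (comp_op \<phi>) n powr (1 / real n))
           \<longlonglongrightarrow> exp_neg_inv (green_cap (closure (\<phi> ` unit_disk)))"
proof -
  obtain C where upper: "\<And>m. approx_num (comp_op \<phi>) (Suc m) \<le> C * \<beta> ^ m"
    using approx_num_comp_op_le_if_image_subset[OF \<phi>(1) p \<beta> outer] by blast
  have lower: "\<exists>c>0. \<forall>m. c * s ^ m \<le> approx_num (comp_op \<phi>) (Suc m)" if s: "0 < s" "s < \<beta>" for s
  proof -
    obtain q where q: "cmod q < 1" "pseudo_cball q s \<subseteq> \<phi> ` unit_disk" using inner[OF s] by auto
    have "s \<le> 1" using s \<beta> by simp
    then obtain c where "0 < c" "\<And>m. c * s ^ m \<le> approx_num (comp_op \<phi>) (Suc m)"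
      using approx_num_comp_op_ge_if_subset_image[OF \<phi> q(1) s(1) _ q(2)] by blast
    thus ?thesis by blast
  qed
  have "green_V (closure (\<phi> ` unit_disk)) = ennreal (ln (1 / \<beta>))"
  proof (rule green_V_eqI[OF p \<beta>])
    show "closure (\<phi> ` unit_disk) \<inter> unit_disk \<subseteq> pseudo_cball p \<beta>"
      using closure_mono[OF outer] closure_pseudo_ball_subset[OF p] by blast
    show "\<exists>q. cmod q < 1 \<and> pseudo_cball q s \<subseteq> closure (\<phi> ` unit_disk)" if "0 < s" "s < \<beta>" for s
      using inner[OF that] closure_subset by blast
  qed
  hence "exp_neg_inv (green_cap (closure (\<phi> ` unit_disk))) = \<beta>" using \<beta> by (rule exp_neg_inv_green_cap)
  thus ?thesis using powr_inverse_tendsto_growth_rate[OF \<beta>(1) upper lower] by simp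
qed

section \<open>Euclidean disks and fractional linear maps\<close>

lemma mem_pseudo_ball_iff:
  assumes p: "cmod p < 1" and s: "s \<le> 1"
  shows "z \<in> pseudo_ball p s \<longleftrightarrow> cmod (z - p) < s * cmod (1 - cnj p * z)"
proof -
  have "z \<in> unit_disk" if "cmod (z - p) < s * cmod (1 - cnj p * z)"
  proof -
    have "s * cmod (1 - cnj p * z) \<le> cmod (1 - cnj p * z)" using s mult_right_mono[of s 1] by fastforce
    with that have "(cmod (z - p))\<^sup>2 < (cmod (1 - cnj p * z))\<^sup>2" by (intro power_strict_mono) auto
    hence "0 < (1 - (cmod z)\<^sup>2) * (1 - (cmod p)\<^sup>2)"
      unfolding norm_one_minus_cnj_mult_identity[symmetric] by simp
    moreover have "(cmod p)\<^sup>2 < 1" using p by (simp add: abs_square_less_1)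
    ultimately show ?thesis by (simp add: zero_less_mult_iff abs_square_less_1)
  qed
  moreover have "cmod (disk_moebius p z) < s \<longleftrightarrow> cmod (z - p) < s * cmod (1 - cnj p * z)"
      if "z \<in> unit_disk"
    using one_minus_cnj_mult_nonzero[of p z] p that
    by (simp add: Moebius_function_simple norm_divide divide_less_eq)
  ultimately show ?thesis by (auto simp: pseudo_ball_def)
qed

lemma mem_pseudo_cball_iff:
  assumes p: "cmod p < 1" and s: "s < 1"
  shows "z \<in> pseudo_cball p s \<longleftrightarrow> cmod (z - p) \<le> s * cmod (1 - cnj p * z)"
proof -
  have "z \<in> unit_disk" if le: "cmod (z - p) \<le> s * cmod (1 - cnj p * z)"
  proof (cases "z = p")
    case False
    hence "0 < s * cmod (1 - cnj p * z)" using le by (smt (verit) right_minus_eq zero_less_norm_iff)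
    hence "s * cmod (1 - cnj p * z) < cmod (1 - cnj p * z)"
      using s by (simp add: zero_less_mult_iff)
    hence "z \<in> pseudo_ball p 1" using le by (subst mem_pseudo_ball_iff[OF p]) auto
    thus ?thesis by (simp add: pseudo_ball_def)
  qed (use p in simp)
  moreover have "cmod (disk_moebius p z) \<le> s \<longleftrightarrow> cmod (z - p) \<le> s * cmod (1 - cnj p * z)"
      if "z \<in> unit_disk"
    using one_minus_cnj_mult_nonzero[of p z] p that
    by (simp add: Moebius_function_simple norm_divide divide_le_eq)
  ultimately show ?thesis by (auto simp: pseudo_cball_def)
qed

lemma apollonius_identity:
  fixes p z :: complex and s :: real
  defines "P \<equiv> (cmod p)\<^sup>2"
  defines "D \<equiv> 1 - s\<^sup>2 * P"
  assumes "D \<noteq> 0"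
  shows "(s * cmod (1 - cnj p * z))\<^sup>2 - (cmod (z - p))\<^sup>2
       = D * ((s * (1 - P) / D)\<^sup>2 - (cmod (z - of_real ((1 - s\<^sup>2) / D) * p))\<^sup>2)"
proof -
  define X Y where "X = (cmod z)\<^sup>2" and "Y = Re (cnj p * z)"
  have distance: "(cmod (z - of_real t * p))\<^sup>2 = X - 2 * t * Y + t\<^sup>2 * P" for t
    unfolding X_def Y_def P_def cmod_power2 by (simp add: power2_eq_square algebra_simps)
  have "(cmod (1 - cnj p * z))\<^sup>2 = 1 - 2 * Y + P * X"
    unfolding X_def Y_def P_def cmod_power2 by (simp add: power2_eq_square algebra_simps)
  hence "(s * cmod (1 - cnj p * z))\<^sup>2 - (cmod (z - p))\<^sup>2 = s\<^sup>2 * (1 - 2 * Y + P * X) - (X - 2 * Y + P)"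
    using distance[of 1] by (simp add: power_mult_distrib)
  also have "\<dots> = D * ((s * (1 - P) / D)\<^sup>2 - (X - 2 * ((1 - s\<^sup>2) / D) * Y + ((1 - s\<^sup>2) / D)\<^sup>2 * P))"
  proof -
    define t r where "t = (1 - s\<^sup>2) / D" and "r = s * (1 - P) / D"
    have t: "D * t = 1 - s\<^sup>2" and r: "D * r = s * (1 - P)" using \<open>D \<noteq> 0\<close> by (simp_all add: t_def r_def)
    have "D * (D * (r\<^sup>2 - (X - 2 * t * Y + t\<^sup>2 * P)))
        = (D * r)\<^sup>2 - (D\<^sup>2 * X - 2 * (D * t) * D * Y + (D * t)\<^sup>2 * P)"
      by algebra
    also have "\<dots> = D * (s\<^sup>2 * (1 - 2 * Y + P * X) - (X - 2 * Y + P))"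
      unfolding t r unfolding D_def by algebra
    finally show ?thesis using \<open>D \<noteq> 0\<close> by (simp add: t_def r_def)
  qed
  finally show ?thesis by (simp only: distance)
qed

lemma pseudo_ball_eq_ball:
  assumes p: "cmod p < 1" and s: "0 < s" "s < 1"
  defines "D \<equiv> 1 - s\<^sup>2 * (cmod p)\<^sup>2"
  defines "c \<equiv> of_real ((1 - s\<^sup>2) / D) * p" and "r \<equiv> s * (1 - (cmod p)\<^sup>2) / D"
  shows "pseudo_ball p s = ball c r" and "pseudo_cball p s = cball c r"
proof -
  have less_iff: "x < y \<longleftrightarrow> 0 < y\<^sup>2 - x\<^sup>2" and le_iff: "x \<le> y \<longleftrightarrow> 0 \<le> y\<^sup>2 - x\<^sup>2"
    if "0 \<le> x" "0 \<le> y" for x y :: real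
    using that power_mono_iff[of y x 2] power_mono_iff[of x y 2] by (auto simp: not_le[symmetric])
  have "s * cmod p < 1 * 1" using p s by (intro mult_strict_mono) auto
  hence D: "0 < D"
    using s abs_square_less_1[of "s * cmod p"] by (simp add: D_def power_mult_distrib abs_mult)
  have r: "0 \<le> r" using D p s by (simp add: r_def power_le_one)
  have identity: "(s * cmod (1 - cnj p * z))\<^sup>2 - (cmod (z - p))\<^sup>2 = D * (r\<^sup>2 - (cmod (z - c))\<^sup>2)" for z
    using apollonius_identity[of s p z] D unfolding D_def c_def r_def by simp
  have "cmod (z - p) < s * cmod (1 - cnj p * z) \<longleftrightarrow> cmod (z - c) < r" for z
  proof -
    have "cmod (z - p) < s * cmod (1 - cnj p * z) \<longleftrightarrow> 0 < D * (r\<^sup>2 - (cmod (z - c))\<^sup>2)"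
      using s by (subst less_iff) (auto simp: identity)
    also have "\<dots> \<longleftrightarrow> cmod (z - c) < r"
      using D r less_iff[of "cmod (z - c)" r] by (simp add: zero_less_mult_iff)
    finally show ?thesis .
  qed
  thus "pseudo_ball p s = ball c r"
    using s by (auto simp: mem_pseudo_ball_iff[OF p] dist_norm norm_minus_commute)
  have "cmod (z - p) \<le> s * cmod (1 - cnj p * z) \<longleftrightarrow> cmod (z - c) \<le> r" for z
  proof -
    have "cmod (z - p) \<le> s * cmod (1 - cnj p * z) \<longleftrightarrow> 0 \<le> D * (r\<^sup>2 - (cmod (z - c))\<^sup>2)"
      using s by (subst le_iff) (auto simp: identity)
    also have "\<dots> \<longleftrightarrow> cmod (z - c) \<le> r"
      using D r le_iff[of "cmod (z - c)" r] by (simp add: zero_le_mult_iff)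
    finally show ?thesis .
  qed
  thus "pseudo_cball p s = cball c r"
    using s by (auto simp: mem_pseudo_cball_iff[OF p] dist_norm norm_minus_commute)
qed

text \<open>If \<open>e = 1\<close>, the endpoints on the real diameter are \<open>tanh (x - y)\<close> and \<open>tanh (x + y)\<close>, because
  \<open>tanh\<close> conjugates translations to real Moebius maps.\<close>

lemma pseudo_ball_tanh:
  fixes x y :: real and e :: complex
  assumes e: "cmod e = 1" and y: "0 < y"
  defines "c \<equiv> of_real ((tanh (x + y) + tanh (x - y)) / 2) * e"
    and "r \<equiv> (tanh (x + y) - tanh (x - y)) / 2"
  shows "pseudo_ball (of_real (tanh x) * e) (tanh y) = ball c r"
    and "pseudo_cball (of_real (tanh x) * e) (tanh y) = cball c r"
proof -
  define t s where "t = tanh x" and "s = tanh y"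
  define D where "D = 1 - s\<^sup>2 * t\<^sup>2"
  have t: "\<bar>t\<bar> < 1" using tanh_real_bounds[of x] by (auto simp: t_def)
  have s: "0 < s" "s < 1" using y tanh_real_lt_1[of y] by (auto simp: s_def)
  have "\<bar>t * s\<bar> < 1" using mult_strict_mono[of "\<bar>t\<bar>" 1 s 1] t s by (simp add: abs_mult)
  hence ts: "0 < 1 + t * s" "0 < 1 - t * s" by auto
  have D: "D = (1 + t * s) * (1 - t * s)" unfolding D_def by algebra
  have tanh_sum: "tanh (x + y) = (t + s) / (1 + t * s)" by (simp add: tanh_add t_def s_def)
  have tanh_diff: "tanh (x - y) = (t - s) / (1 - t * s)"
    using tanh_add[of x "- y"] by (simp add: t_def s_def)
  have "(tanh (x + y) + tanh (x - y)) / 2 = (1 - s\<^sup>2) / D * t"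
    unfolding tanh_sum tanh_diff D using ts
    by (simp add: divide_simps) (simp add: algebra_simps power2_eq_square)
  hence c: "c = of_real ((1 - s\<^sup>2) / D) * (of_real t * e)" by (simp add: c_def)
  have r: "r = s * (1 - t\<^sup>2) / D"
    unfolding r_def tanh_sum tanh_diff D using ts
    by (simp add: divide_simps) (simp add: algebra_simps power2_eq_square)
  have norm: "cmod (of_real t * e) < 1" "(cmod (of_real t * e))\<^sup>2 = t\<^sup>2"
    using t e by (auto simp: norm_mult)
  show "pseudo_ball (of_real (tanh x) * e) (tanh y) = ball c r"
    and "pseudo_cball (of_real (tanh x) * e) (tanh y) = cball c r"
    using pseudo_ball_eq_ball[OF norm(1) s]
    unfolding norm(2) c r D_def t_def[symmetric] s_def[symmetric] by simp_all
qed

lemma tanh_artanh_real: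
  fixes x :: real
  assumes "\<bar>x\<bar> < 1"
  shows "tanh (artanh x) = x"
proof -
  have "exp (- 2 * artanh x) = (1 - x) / (1 + x)"
    using assms by (simp add: artanh_def exp_minus)
  hence "tanh (artanh x) = (1 - (1 - x) / (1 + x)) / (1 + (1 - x) / (1 + x))"
    by (simp only: tanh_real_altdef)
  moreover have "1 + x \<noteq> 0" using assms by auto
  ultimately show ?thesis by (simp add: divide_simps)
qed

lemma ball_eq_pseudo_ball:
  assumes r: "0 < r" and inside: "cmod c + r < 1"
  obtains p s where "cmod p < 1" "0 < s" "s < 1" "ball c r = pseudo_ball p s"
proof -
  define x y where "x = (artanh (cmod c + r) + artanh (cmod c - r)) / 2"
    and "y = (artanh (cmod c + r) - artanh (cmod c - r)) / 2"
  have "\<bar>cmod c + r\<bar> < 1" "\<bar>cmod c - r\<bar> < 1" using r inside norm_ge_zero[of c] by linarith+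
  moreover have "x + y = artanh (cmod c + r)" "x - y = artanh (cmod c - r)"
    by (simp_all add: x_def y_def field_simps)
  ultimately have ends: "tanh (x + y) = cmod c + r" "tanh (x - y) = cmod c - r"
    by (simp_all add: tanh_artanh_real)
  hence "tanh (x - y) < tanh (x + y)" using r by simp
  hence y: "0 < y" by simp
  have "ball c r = pseudo_ball (of_real (tanh x) * cis (Arg c)) (tanh y)"
    using pseudo_ball_tanh(1)[of "cis (Arg c)" y x] y rcis_cmod_Arg[of c] by (simp add: ends rcis_def)
  moreover have "cmod (of_real (tanh x) * cis (Arg c)) < 1"
    using tanh_real_bounds[of x] by (auto simp: norm_mult)
  ultimately show thesis using that[of "of_real (tanh x) * cis (Arg c)" "tanh y"]
      y tanh_real_lt_1[of y] by simp
qed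

lemma pseudo_cball_subset_tangent_ball:
  assumes r: "0 < r" and tangent: "cmod c + r = 1" and s: "0 < s" "s < 1"
  obtains p where "cmod p < 1" "pseudo_cball p s \<subseteq> ball c r"
proof -
  define y where "y = artanh s"
  have y: "tanh y = s" using s by (simp add: y_def tanh_artanh_real)
  hence "0 < y" using s tanh_real_pos_iff[of y] by simp
  obtain u where u: "0 < u" "cmod c - r < u" "u < 1"
    using dense[of "max 0 (cmod c - r)" 1] r tangent by auto
  define x where "x = y + artanh u"
  have x: "tanh (x - y) = u" using u by (simp add: x_def tanh_artanh_real)
  define \<gamma> \<rho> where "\<gamma> = (tanh (x + y) + tanh (x - y)) / 2" and "\<rho> = (tanh (x + y) - tanh (x - y)) / 2"
  have "c = of_real (cmod c) * cis (Arg c)" using rcis_cmod_Arg[of c] by (simp add: rcis_def)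
  hence "of_real \<gamma> * cis (Arg c) - c = of_real (\<gamma> - cmod c) * cis (Arg c)" by (simp add: algebra_simps)
  hence "dist (of_real \<gamma> * cis (Arg c)) c = \<bar>\<gamma> - cmod c\<bar>"
    by (simp add: dist_norm norm_mult del: of_real_diff)
  moreover have "cmod c - r < \<gamma> - \<rho>" "\<gamma> + \<rho> < cmod c + r"
    using x u tangent tanh_real_lt_1[of "x + y"] by (simp_all add: \<gamma>_def \<rho>_def field_simps)
  ultimately have "cball (of_real \<gamma> * cis (Arg c)) \<rho> \<subseteq> ball c r"
    by (simp add: cball_subset_ball_iff abs_if)
  hence "pseudo_cball (of_real (tanh x) * cis (Arg c)) s \<subseteq> ball c r"
    using pseudo_ball_tanh(2)[of "cis (Arg c)" y x] \<open>0 < y\<close> by (simp add: y \<gamma>_def \<rho>_def)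
  moreover have "cmod (of_real (tanh x) * cis (Arg c)) < 1"
    using tanh_real_bounds[of x] by (auto simp: norm_mult)
  ultimately show thesis using that by blast
qed

lemma ball_between_pseudo_balls:
  assumes r: "0 < r" and inside: "cmod c + r \<le> 1"
  obtains p \<beta> where "cmod p < 1" "0 < \<beta>" "\<beta> \<le> 1" "ball c r \<subseteq> pseudo_ball p \<beta>"
    "\<And>s. 0 < s \<Longrightarrow> s < \<beta> \<Longrightarrow> \<exists>q. cmod q < 1 \<and> pseudo_cball q s \<subseteq> ball c r"
proof (cases "cmod c + r < 1")
  case True
  obtain p \<beta> where p: "cmod p < 1" "0 < \<beta>" "\<beta> < 1" "ball c r = pseudo_ball p \<beta>"
    using ball_eq_pseudo_ball[OF r True] .
  moreover have "\<exists>q. cmod q < 1 \<and> pseudo_cball q s \<subseteq> ball c r" if "s < \<beta>" for s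
    using p pseudo_cball_subset_pseudo_ball[OF that] by blast
  ultimately show thesis using that[of p \<beta>] by simp
next
  case False
  hence tangent: "cmod c + r = 1" using inside by simp
  have "ball c r \<subseteq> unit_disk" using inside by (simp add: ball_subset_ball_iff dist_norm)
  hence "ball c r \<subseteq> pseudo_ball 0 1" by (auto simp: pseudo_ball_def Moebius_function_simple)
  moreover have "\<exists>q. cmod q < 1 \<and> pseudo_cball q s \<subseteq> ball c r" if "0 < s" "s < 1" for s
    using pseudo_cball_subset_tangent_ball[OF r tangent that] by blast
  ultimately show thesis by (intro that[of 0 1]) auto
qed

abbreviation fractional_linear :: "complex \<Rightarrow> complex \<Rightarrow> complex \<Rightarrow> complex \<Rightarrow> complex \<Rightarrow> complex" where
  "fractional_linear a b c d \<equiv> \<lambda>z. (a * z + b) / (c * z + d)"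

lemma norm_numerator_le_denominator_on_circle:
  assumes cond: "(cmod a)\<^sup>2 + (cmod b)\<^sup>2 + 2 * cmod (cnj a * b - cnj c * d) \<le> (cmod c)\<^sup>2 + (cmod d)\<^sup>2"
    and z: "cmod z = 1"
  shows "cmod (a * z + b) \<le> cmod (c * z + d)"
proof -
  have expand: "(cmod (x * z + y))\<^sup>2 = (cmod x)\<^sup>2 + (cmod y)\<^sup>2 + 2 * Re (cnj (cnj x * y) * z)" for x y
  proof -
    have "(cmod (x * z + y))\<^sup>2 = (cmod (x * z))\<^sup>2 + (cmod y)\<^sup>2 + 2 * Re (cnj (cnj x * y) * z)"
      unfolding cmod_power2 by (simp add: power2_eq_square algebra_simps)
    thus ?thesis using z by (simp add: norm_mult)
  qed
  have "(cmod (c * z + d))\<^sup>2 - (cmod (a * z + b))\<^sup>2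
      = (cmod c)\<^sup>2 + (cmod d)\<^sup>2 - (cmod a)\<^sup>2 - (cmod b)\<^sup>2 - 2 * Re (cnj (cnj a * b - cnj c * d) * z)"
    unfolding expand by (simp add: algebra_simps)
  moreover have "Re (cnj (cnj a * b - cnj c * d) * z) \<le> cmod (cnj a * b - cnj c * d)"
    using complex_Re_le_cmod[of "cnj (cnj a * b - cnj c * d) * z"] z
    unfolding norm_mult complex_mod_cnj by simp
  ultimately have "(cmod (a * z + b))\<^sup>2 \<le> (cmod (c * z + d))\<^sup>2" using cond by linarith
  thus ?thesis by (rule power2_le_imp_le) simp
qed

lemma denominator_nonzero:
  fixes c d z :: complex
  assumes "cmod c < cmod d" "cmod z \<le> 1"
  shows "c * z + d \<noteq> 0"
proof
  assume "c * z + d = 0"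
  hence "c * z = - d" by (simp add: eq_neg_iff_add_eq_0)
  hence "cmod c * cmod z = cmod d" by (metis norm_minus_cancel norm_mult)
  thus False using assms mult_left_le[of "cmod z" "cmod c"] by simp
qed

lemma fractional_linear_moebius_decomposition:
  assumes nondeg: "a * d - b * c \<noteq> 0" and cd: "cmod c < cmod d"
  obtains w \<kappa> q where "cmod q < 1" "\<kappa> \<noteq> 0"
    "\<forall>z\<in>unit_disk. fractional_linear a b c d z = w + \<kappa> * disk_moebius q z"
proof -
  have d: "d \<noteq> 0" using cd by auto
  define q where "q = - cnj (c / d)"
  have q: "cmod q < 1" using cd d by (simp add: q_def norm_divide)
  define \<Delta> where "\<Delta> = d * cnj d - c * cnj c"
  have "\<Delta> = of_real ((cmod d)\<^sup>2 - (cmod c)\<^sup>2)"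
    unfolding \<Delta>_def by (simp flip: complex_norm_square)
  moreover have "(cmod c)\<^sup>2 < (cmod d)\<^sup>2" using cd by (intro power_strict_mono) auto
  ultimately have \<Delta>: "\<Delta> \<noteq> 0" by (metis diff_gt_0_iff_gt less_irrefl of_real_eq_0_iff)
  define w where "w = (b * cnj d - a * cnj c) / \<Delta>"
  define \<kappa> where "\<kappa> = (a * d - b * c) * cnj d / (\<Delta> * d)"
  have "fractional_linear a b c d z = w + \<kappa> * disk_moebius q z" if z: "z \<in> unit_disk" for z
  proof -
    have nz: "c * z + d \<noteq> 0" using denominator_nonzero[OF cd] z by simp
    have "disk_moebius q z = (z + cnj c / cnj d) / (1 + c / d * z)"
      by (simp add: Moebius_function_simple q_def)
    also have "\<dots> = ((cnj d * z + cnj c) * d) / (cnj d * (c * z + d))"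
      using nz d by (simp add: divide_simps) (simp add: algebra_simps)
    finally have "\<kappa> * disk_moebius q z = (a * d - b * c) * (cnj d * z + cnj c) / (\<Delta> * (c * z + d))"
      using d \<Delta> nz by (simp add: \<kappa>_def)
    hence "w + \<kappa> * disk_moebius q z
        = ((b * cnj d - a * cnj c) * (c * z + d) + (a * d - b * c) * (cnj d * z + cnj c))
            / (\<Delta> * (c * z + d))"
      using \<Delta> nz by (simp add: w_def add_divide_distrib)
    also have "(b * cnj d - a * cnj c) * (c * z + d) + (a * d - b * c) * (cnj d * z + cnj c)
        = \<Delta> * (a * z + b)"
      unfolding \<Delta>_def by (simp add: algebra_simps)
    finally show ?thesis using \<Delta> by simp
  qed
  moreover have "\<kappa> \<noteq> 0" using nondeg d \<Delta> by (simp add: \<kappa>_def)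
  ultimately show thesis using that q by blast
qed

lemma disk_moebius_image_unit_disk:
  assumes "cmod p < 1"
  shows "disk_moebius p ` unit_disk = unit_disk"
proof (intro subset_antisym subsetI)
  fix z assume "z \<in> unit_disk"
  hence "z = disk_moebius p (disk_moebius (- p) z)" "disk_moebius (- p) z \<in> unit_disk"
    using assms disk_self_map_norm_less_one[OF disk_self_map_moebius[of "- p"]]
    by (auto simp: disk_moebius_inverse)
  thus "z \<in> disk_moebius p ` unit_disk" by blast
qed (use disk_self_map_norm_less_one[OF disk_self_map_moebius[OF assms]] in auto)

lemma affine_image_unit_disk:
  fixes w \<kappa> :: complex
  assumes "\<kappa> \<noteq> 0"
  shows "(\<lambda>u. w + \<kappa> * u) ` unit_disk = ball w (cmod \<kappa>)"
proof (intro subset_antisym subsetI)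
  fix x assume "x \<in> ball w (cmod \<kappa>)"
  hence "(x - w) / \<kappa> \<in> unit_disk" "x = w + \<kappa> * ((x - w) / \<kappa>)"
    using assms by (auto simp: dist_norm norm_divide norm_minus_commute)
  thus "x \<in> (\<lambda>u. w + \<kappa> * u) ` unit_disk" by blast
qed (use assms in \<open>auto simp: dist_norm norm_mult\<close>)

lemma fractional_linear_bijects_disk_onto_ball:
  assumes nondeg: "a * d - b * c \<noteq> 0" and cd: "cmod c < cmod d"
  obtains w r where "0 < r" "fractional_linear a b c d ` unit_disk = ball w r"
    "inj_on (fractional_linear a b c d) unit_disk"
proof -
  obtain w \<kappa> q where q: "cmod q < 1" and \<kappa>: "\<kappa> \<noteq> 0"
    and decomposition: "\<forall>z\<in>unit_disk. fractional_linear a b c d z = w + \<kappa> * disk_moebius q z"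
    using fractional_linear_moebius_decomposition[OF nondeg cd] .
  have "fractional_linear a b c d ` unit_disk = (\<lambda>u. w + \<kappa> * u) ` disk_moebius q ` unit_disk"
    unfolding image_image by (intro image_cong refl bspec[OF decomposition])
  also have "\<dots> = ball w (cmod \<kappa>)"
    unfolding disk_moebius_image_unit_disk[OF q] by (rule affine_image_unit_disk[OF \<kappa>])
  finally have "fractional_linear a b c d ` unit_disk = ball w (cmod \<kappa>)" .
  moreover have "inj_on (disk_moebius q) unit_disk"
    using q by (intro inj_on_inverseI[of _ "disk_moebius (- q)"]) (simp add: disk_moebius_inverse)
  hence "inj_on (fractional_linear a b c d) unit_disk"
    using \<kappa> by (simp add: inj_on_def decomposition)
  ultimately show thesis using that[of "cmod \<kappa>" w] \<kappa> by simp
qed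

lemma fractional_linear_norm_le_one:
  assumes circle: "\<And>z. cmod z = 1 \<Longrightarrow> cmod (a * z + b) \<le> cmod (c * z + d)"
    and cd: "cmod c < cmod d" and z: "z \<in> unit_disk"
  shows "cmod (fractional_linear a b c d z) \<le> 1"
proof (rule maximum_modulus_frontier[of "fractional_linear a b c d" unit_disk])
  have "fractional_linear a b c d holomorphic_on cball 0 1"
    using denominator_nonzero[OF cd] by (intro holomorphic_intros) auto
  thus "fractional_linear a b c d holomorphic_on interior unit_disk"
    "continuous_on (closure unit_disk) (fractional_linear a b c d)"
    by (auto intro: holomorphic_on_imp_continuous_on)
  show "cmod (fractional_linear a b c d u) \<le> 1" if "u \<in> frontier unit_disk" for u
    using that circle[of u] denominator_nonzero[OF cd, of u] by (auto simp: norm_divide divide_le_eq)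
qed (use z in auto)

lemma fractional_linear_disk_self_map_onto_ball:
  assumes nondeg: "a * d - b * c \<noteq> 0"
    and cond1: "(cmod a)\<^sup>2 + (cmod b)\<^sup>2 + 2 * cmod (cnj a * b - cnj c * d) \<le> (cmod c)\<^sup>2 + (cmod d)\<^sup>2"
    and cond2: "cmod c \<le> cmod d"
  obtains w r where "0 < r" "cmod w + r \<le> 1" "disk_self_map (fractional_linear a b c d)"
    "inj_on (fractional_linear a b c d) unit_disk" "fractional_linear a b c d ` unit_disk = ball w r"
proof -
  note circle = norm_numerator_le_denominator_on_circle[OF cond1]
  have "cmod c \<noteq> cmod d"
  proof
    assume eq: "cmod c = cmod d"
    hence c: "c \<noteq> 0" using nondeg by auto
    have "cmod (- d / c) = 1" using c by (simp add: norm_divide eq[symmetric])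
    from circle[OF this] have "a * (- d / c) + b = 0" using c by simp
    thus False using c nondeg by (simp add: field_simps)
  qed
  hence cd: "cmod c < cmod d" using cond2 by simp
  obtain w r where image: "0 < r" "fractional_linear a b c d ` unit_disk = ball w r"
    and inj: "inj_on (fractional_linear a b c d) unit_disk"
    using fractional_linear_bijects_disk_onto_ball[OF nondeg cd] .
  have "ball w r \<subseteq> cball 0 1"
    unfolding image(2)[symmetric] using fractional_linear_norm_le_one[OF circle cd] by auto
  hence norm_w: "cmod w + r \<le> 1" using image(1) by (simp add: ball_subset_cball_iff)
  hence "ball w r \<subseteq> unit_disk" using image(1) by (simp add: ball_subset_ball_iff)
  moreover have "fractional_linear a b c d holomorphic_on unit_disk"
    using denominator_nonzero[OF cd] by (intro holomorphic_intros) auto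
  ultimately have "disk_self_map (fractional_linear a b c d)" by (simp add: disk_self_map_def image(2))
  thus thesis using that image norm_w inj by blast
qed

theorem theorem3p2:
  fixes a b c d :: complex
  assumes nondeg: "a * d - b * c \<noteq> 0"
    and cond1: "(cmod a)\<^sup>2 + (cmod b)\<^sup>2 + 2 * cmod (cnj a * b - cnj c * d) \<le> (cmod c)\<^sup>2 + (cmod d)\<^sup>2"
    and cond2: "cmod c \<le> cmod d"
  defines "\<phi> \<equiv> (\<lambda>z. (a * z + b) / (c * z + d))"
  defines "K \<equiv> closure (\<phi> ` unit_disk)"
  shows "(\<lambda>n. approx_num (comp_op \<phi>) n powr (1 / real n))
           \<longlonglongrightarrow> exp_neg_inv (green_cap K)"
proof -
  obtain w r where r: "0 < r" "cmod w + r \<le> 1" and \<phi>: "disk_self_map \<phi>" "inj_on \<phi> unit_disk"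
    and image: "\<phi> ` unit_disk = ball w r"
    unfolding \<phi>_def using fractional_linear_disk_self_map_onto_ball[OF nondeg cond1 cond2] .
  obtain p \<beta> where "cmod p < 1" "0 < \<beta>" "\<beta> \<le> 1" "ball w r \<subseteq> pseudo_ball p \<beta>"
    "\<And>s. 0 < s \<Longrightarrow> s < \<beta> \<Longrightarrow> \<exists>q. cmod q < 1 \<and> pseudo_cball q s \<subseteq> ball w r"
    using ball_between_pseudo_balls[OF r] by blast
  thus ?thesis
    unfolding K_def image[symmetric] by (rule approx_num_limit_eq_green_cap[OF \<phi>])
qed

end
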